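(* Let $p\in(1,2)$ and $p'=p/(p-1)$. For any $\varepsilon>0$ there exists $\delta>0$ such that for any dimension $d\ge 1$ and any $(1-\delta)$-near extremizer $f\in\ell^p(\mathbb{Z}^d)$ for the Hausdorff-Young inequality, there exists $z\in\mathbb{Z}^d$ such that $\|f\|_{L^p(\mathbb{Z}^d\setminus\{z\})}<\varepsilon\|f\|_p$. More precisely, there exist a continuous nondecreasing function $\Lambda:(0,1]\to(0,1]$, an exponent $\gamma\in(0,\infty)$, and a constant $c>0$ satisfying \[ \Lambda(t)\le 1-c(1-t)^\gamma\quad\text{as } t\to 1^- \] (that is, for all $t<1$ sufficiently close to $1$) such that for any $d\ge 1$ and for any nonzero function $f\in\ell^p(\mathbb{Z}^d)$, \[ \|\widehat{f}\|_{p'}\le\|f\|_p\cdot\Lambda\Big(\frac{\|f\|_{\infty}}{\|f\|_{p}}\Big). \]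
   Context: $\mathbb{Z}^d$ is equipped with counting measure, functions are complex-valued, $\|f\|_p=(\sum_{x\in\mathbb{Z}^d}|f(x)|^p)^{1/p}$, $\|f\|_\infty=\sup_x|f(x)|$, and $\|f\|_{L^p(E)}=(\sum_{x\in E}|f(x)|^p)^{1/p}$ for $E\subset\mathbb{Z}^d$. $\mathbb{T}^d=\mathbb{R}^d/\mathbb{Z}^d$ is equipped with the measure that pulls back to Lebesgue measure on $\mathbb{R}^d$ under the natural projection (so it has total mass $1$), and $\|g\|_{q}=\|g\|_{L^q(\mathbb{T}^d)}=(\int_{\mathbb{T}^d}|g(y)|^q\,dy)^{1/q}$. The Fourier transform is $\widehat{f}(\xi)=\sum_{x\in\mathbb{Z}^d}e^{-2\pi i\xi\cdot x}f(x)$ (for $f\in\ell^p\subset\ell^2$ the sum is understood in the $L^2(\mathbb{T}^d)$ sense). The Hausdorff-Young inequality is $\|\widehat{f}\|_{L^{p'}(\mathbb{T}^d)}\le\|f\|_{\ell^p(\mathbb{Z}^d)}$ for $1\le p\le 2$. A nonzero $f\in\ell^p(\mathbb{Z}^d)$ is a $(1-\delta)$-near extremizer for this inequality if $\|\widehat{f}\|_{p'}\ge(1-\delta)\|f\|_p$. *)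

theory Defs
  imports "HOL-Analysis.Analysis"
begin

text \<open>
  The dimension \<open>d\<close> is quantified inside the theorem, so it is a natural number rather than a
  type: points of \<open>\<int>\<^sup>d\<close> and of the torus are functions on \<open>{..<d}\<close>, made unique by requiring
  the value \<open>undefined\<close> at all other indices.
\<close>

definition int_lattice :: "nat \<Rightarrow> (nat \<Rightarrow> int) set" where
  "int_lattice d = {..<d} \<rightarrow>\<^sub>E UNIV"

text \<open>The torus is represented by its fundamental domain \<open>[0,1)\<^sup>d\<close> with Lebesgue measure.\<close>

definition torus :: "nat \<Rightarrow> (nat \<Rightarrow> real) measure" where
  "torus d = (\<Pi>\<^sub>M j\<in>{..<d}. restrict_space lborel {0..<1})"

definition in_lp :: "'a set \<Rightarrow> real \<Rightarrow> ('a \<Rightarrow> complex) \<Rightarrow> bool" where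
  "in_lp E p f \<longleftrightarrow> (\<lambda>x. cmod (f x) powr p) summable_on E"

definition lp_norm :: "'a set \<Rightarrow> real \<Rightarrow> ('a \<Rightarrow> complex) \<Rightarrow> real" where
  "lp_norm E p f = (\<Sum>\<^sub>\<infinity>x\<in>E. cmod (f x) powr p) powr (1 / p)"

definition sup_norm :: "'a set \<Rightarrow> ('a \<Rightarrow> complex) \<Rightarrow> real" where
  "sup_norm E f = (SUP x\<in>E. cmod (f x))"

text \<open>
  The \<open>L\<^sup>q\<close> norm takes values in \<open>[0,\<infinity>]\<close>, so that an upper bound on it includes the claim that
  it is finite.
\<close>

definition Lq_norm :: "'b measure \<Rightarrow> real \<Rightarrow> ('b \<Rightarrow> complex) \<Rightarrow> ennreal" where
  "Lq_norm M q g =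
    (let I = (\<integral>\<^sup>+ y. ennreal (cmod (g y) powr q) \<partial>M)
     in if I = \<infinity> then \<infinity> else ennreal (enn2real I powr (1 / q)))"

definition fourier_mode :: "nat \<Rightarrow> (nat \<Rightarrow> int) \<Rightarrow> (nat \<Rightarrow> real) \<Rightarrow> complex" where
  "fourier_mode d x \<xi> = exp (- 2 * of_real pi * \<i> * of_real (\<Sum>j<d. \<xi> j * of_int (x j)))"

text \<open>
  The Fourier series is summed unconditionally in \<open>L\<^sup>2\<close> of the torus; the sum exists for every
  square-summable \<open>f\<close> and is unique up to null sets. The transform is a representative.
\<close>

definition is_fourier_transform ::
    "nat \<Rightarrow> ((nat \<Rightarrow> int) \<Rightarrow> complex) \<Rightarrow> ((nat \<Rightarrow> real) \<Rightarrow> complex) \<Rightarrow> bool" where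
  "is_fourier_transform d f g \<longleftrightarrow>
    g \<in> borel_measurable (torus d) \<and>
    ((\<lambda>F. Lq_norm (torus d) 2 (\<lambda>\<xi>. g \<xi> - (\<Sum>x\<in>F. fourier_mode d x \<xi> * f x))) \<longlongrightarrow> 0)
      (finite_subsets_at_top (int_lattice d))"

definition fourier_transform ::
    "nat \<Rightarrow> ((nat \<Rightarrow> int) \<Rightarrow> complex) \<Rightarrow> ((nat \<Rightarrow> real) \<Rightarrow> complex)" where
  "fourier_transform d f = (SOME g. is_fourier_transform d f g)"

definition near_extremizer ::
    "nat \<Rightarrow> real \<Rightarrow> real \<Rightarrow> ((nat \<Rightarrow> int) \<Rightarrow> complex) \<Rightarrow> bool" where
  "near_extremizer d p \<delta> f \<longleftrightarrow>
    in_lp (int_lattice d) p f \<and> (\<exists>x\<in>int_lattice d. f x \<noteq> 0) \<and>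
    Lq_norm (torus d) (p / (p - 1)) (fourier_transform d f)
      \<ge> ennreal ((1 - \<delta>) * lp_norm (int_lattice d) p f)"

end

theory Submission
  imports Defs "HOL-Library.Function_Algebras" "HOL-Complex_Analysis.Complex_Analysis"
    "HOL-Probability.Infinite_Product_Measure"
begin

text \<open>
  Write \<open>f'\<close> for the Fourier transform of \<open>f\<close>. For \<open>p = 4/3\<close>, the fourth power of \<open>\<parallel>f'\<parallel>\<^sub>4\<close> is a sum
  over the additive quadruples \<open>x + y = z + w\<close>. With
  \<open>\<bar>f\<bar> = r\<^bsup>3/2\<^esup>\<close> and \<open>\<Sum>r\<^sup>2 = 1\<close>, the inequality of arithmetic and geometric means bounds this sum by
  the mean of the overlap \<open>\<Sum>\<^sub>z r(z) r(x + y - z)\<close> over independent \<open>x, y\<close> of law \<open>r\<^sup>2\<close>. If it is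
  nearly \<open>1\<close>, then \<open>r\<close> is nearly invariant under most reflections \<open>z \<mapsto> x + y - z\<close>, hence under
  translation by \<open>x - x\<^sub>0\<close> for some \<open>x\<^sub>0\<close> and most \<open>x\<close>. Since the lattice is torsion free, the
  longest such translation in a given coordinate must be zero: otherwise three windows of its length
  would cover most of the mass although each carries little. So \<open>r\<^sup>2\<close> sits essentially at \<open>x\<^sub>0\<close>, with a
  linear bound independent of the dimension.

  In Riesz--Thorin interpolation with \<open>p = 1\<close> or \<open>p = 2\<close>, the analytic family through \<open>f\<close> has on the
  edge \<open>4/3\<close> moduli given by a power of \<open>\<bar>f\<bar>\<close>, so the gain survives for every \<open>p\<close>:
  \<open>\<parallel>f'\<parallel>\<^bsub>p'\<^esub> \<le> (1 - c) \<parallel>f\<parallel>\<^sub>p + c \<parallel>f\<parallel>\<^sub>\<infinity>\<close>, that is \<open>\<Lambda>(t) = 1 - c (1 - t)\<close> and \<open>\<gamma> = 1\<close>. This form is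
  monotone under restriction of \<open>f\<close> to finite sets and passes to the limit by Fatou's lemma.
\<close>

section \<open>Concentration of nearly reflection-invariant weights\<close>

lemma infsum_shift:
  fixes h :: "'a::ab_group_add \<Rightarrow> real"
  shows "(\<Sum>\<^sub>\<infinity>z. h (z - u)) = (\<Sum>\<^sub>\<infinity>z. h z)" "(\<Sum>\<^sub>\<infinity>z. h (s - z)) = (\<Sum>\<^sub>\<infinity>z. h z)"
proof -
  have "bij (\<lambda>z. z - u)" "bij (\<lambda>z. s - z)"
    by (rule bij_betw_byWitness[where f' = "\<lambda>z. z + u"]; simp)
       (rule bij_betw_byWitness[where f' = "\<lambda>z. s - z"]; simp)
  then show "(\<Sum>\<^sub>\<infinity>z. h (z - u)) = (\<Sum>\<^sub>\<infinity>z. h z)" "(\<Sum>\<^sub>\<infinity>z. h (s - z)) = (\<Sum>\<^sub>\<infinity>z. h z)"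
    using infsum_reindex_bij_betw[of _ UNIV UNIV h] by auto
qed

lemma exists_le_weighted_average:
  fixes F g :: "'a \<Rightarrow> real"
  assumes "finite X" "\<And>x. x \<in> X \<Longrightarrow> F x \<ge> 0" "sum F X = 1" "(\<Sum>x\<in>X. F x * g x) \<le> C"
  shows "\<exists>x\<in>X. g x \<le> C"
proof (rule ccontr)
  assume "\<not> ?thesis"
  then have gt: "g x > C" if "x \<in> X" for x using that by auto
  have "X \<noteq> {}" using assms(3) by auto
  then obtain x where x: "x \<in> X" "F x > 0"
    using assms(1-3) by (metis less_eq_real_def sum.neutral zero_neq_one)
  have "C = (\<Sum>x\<in>X. F x * C)" using assms(3) by (simp flip: sum_distrib_right)
  also have "\<dots> < (\<Sum>x\<in>X. F x * g x)"
    using x gt assms(1,2)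
    by (intro sum_strict_mono_ex1 bexI[of _ x]) (auto intro: mult_left_mono less_imp_le)
  finally show False using assms(4) by simp
qed

text \<open>The square of \<open>r\<close> is a probability law on the finite set \<open>X\<close>;
  extending \<open>r\<close> by zero lets reflections and translations leave \<open>X\<close>.
  Additive, jointly injective coordinates embed the group in a power of \<int>. Their index type is
  arbitrary, which keeps every constant independent of the dimension.\<close>

locale unit_weight =
  fixes X :: "'a::ab_group_add set" and r :: "'a \<Rightarrow> real" and coord :: "'j \<Rightarrow> 'a \<Rightarrow> int"
  assumes fin: "finite X" and nonneg: "\<And>x. r x \<ge> 0" and outside: "\<And>x. x \<notin> X \<Longrightarrow> r x = 0"
    and unit: "(\<Sum>x\<in>X. (r x)\<^sup>2) = 1"
    and coord_add: "\<And>j x y. coord j (x + y) = coord j x + coord j y"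
    and coord_eqI: "\<And>x y. (\<And>j. coord j x = coord j y) \<Longrightarrow> x = y"
begin

lemma coord_diff: "coord j (x - y) = coord j x - coord j y"
  using coord_add[of j "x - y" y] by simp

lemma coord_uminus: "coord j (- x) = - coord j x"
  using coord_diff[of j 0 x] coord_add[of j 0 0] by simp

text \<open>Summing over the whole group, though only finitely many terms are nonzero, makes the
  changes of variable in \<open>infsum_shift\<close> available.\<close>

definition refl_dist :: "'a \<Rightarrow> real" where
  "refl_dist s = (\<Sum>\<^sub>\<infinity>z. (r z - r (s - z))\<^sup>2)"

definition shift_dist :: "'a \<Rightarrow> real" where
  "shift_dist u = (\<Sum>\<^sub>\<infinity>z. (r z - r (z - u))\<^sup>2)"

definition mass :: "('a \<Rightarrow> bool) \<Rightarrow> real" where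
  "mass Q = (\<Sum>x\<in>X. (r x)\<^sup>2 * of_bool (Q x))"

lemma finite_supports: "finite {z. r (z - u) \<noteq> 0}" "finite {z. r (s - z) \<noteq> 0}"
proof -
  have "{z. r (z - u) \<noteq> 0} \<subseteq> (\<lambda>x. x + u) ` X"
    using outside by (auto simp: image_iff) (metis diff_add_cancel)
  then show "finite {z. r (z - u) \<noteq> 0}" using fin finite_subset by blast
  have "{z. r (s - z) \<noteq> 0} \<subseteq> (\<lambda>x. s - x) ` X"
    using outside by (auto simp: image_iff) (metis diff_diff_eq2 add_diff_cancel_left')
  then show "finite {z. r (s - z) \<noteq> 0}" using fin finite_subset by blast
qed

lemma finite_support: "finite {z. r z \<noteq> 0}"
  using finite_supports(1)[of 0] by simp

lemma summable:
  assumes "\<And>z. r z = 0 \<Longrightarrow> r (z - u) = 0 \<Longrightarrow> r (s - z) = 0 \<Longrightarrow> h z = 0"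
  shows "h summable_on (UNIV :: 'a set)"
proof -
  have "{z. h z \<noteq> 0} \<subseteq> {z. r z \<noteq> 0} \<union> {z. r (z - u) \<noteq> 0} \<union> {z. r (s - z) \<noteq> 0}"
    using assms by blast
  then have "finite {z\<in>UNIV. h z \<noteq> 0}"
    using finite_support finite_supports by (metis (no_types, lifting) UNIV_I finite_Un finite_subset Collect_cong)
  then show ?thesis by (rule finite_nonzero_values_imp_summable_on)
qed

lemma infsum_support:
  assumes "\<And>z. r z = 0 \<Longrightarrow> h z = 0"
  shows "(\<Sum>\<^sub>\<infinity>z. h z) = sum h X"
proof -
  have "(\<Sum>\<^sub>\<infinity>z. h z) = infsum h X"
    using assms outside by (intro infsum_cong_neutral) auto
  then show ?thesis using fin by simp
qed

lemma infsum_sq: "(\<Sum>\<^sub>\<infinity>z. (r z)\<^sup>2) = 1"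
  using unit by (subst infsum_support) auto

lemma infsum_sq_shift: "(\<Sum>\<^sub>\<infinity>z. (r (z - u))\<^sup>2) = 1" "(\<Sum>\<^sub>\<infinity>z. (r (s - z))\<^sup>2) = 1"
  using infsum_shift[of "\<lambda>z. (r z)\<^sup>2"] infsum_sq by auto

text \<open>Expand the square: \<open>r\<close> and its reflection both have unit norm, so the cross
  term is determined by the distance.\<close>

lemma refl_dist_eq: "(\<Sum>z\<in>X. r z * r (s - z)) = 1 - refl_dist s / 2"
proof -
  have "2 = (\<Sum>\<^sub>\<infinity>z. (r z)\<^sup>2 + (r (s - z))\<^sup>2)"
    by (subst infsum_add) (auto simp: infsum_sq infsum_sq_shift intro!: summable[where u = 0 and s = s])
  also have "\<dots> = (\<Sum>\<^sub>\<infinity>z. (r z - r (s - z))\<^sup>2 + 2 * (r z * r (s - z)))"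
    by (simp add: power2_diff algebra_simps)
  also have "\<dots> = refl_dist s + (\<Sum>\<^sub>\<infinity>z. 2 * (r z * r (s - z)))"
    unfolding refl_dist_def by (intro infsum_add summable[where u = 0 and s = s]) auto
  also have "(\<Sum>\<^sub>\<infinity>z. 2 * (r z * r (s - z))) = 2 * (\<Sum>z\<in>X. r z * r (s - z))"
    by (subst infsum_support) (auto simp: sum_distrib_left)
  finally show ?thesis by simp
qed

lemma refl_dist_nonneg: "refl_dist s \<ge> 0" and shift_dist_nonneg: "shift_dist u \<ge> 0"
  unfolding refl_dist_def shift_dist_def by (auto intro: infsum_nonneg)

lemma shift_dist_uminus: "shift_dist (- u) = shift_dist u"
proof -
  have "shift_dist u = (\<Sum>\<^sub>\<infinity>z. (r (z - - u) - r (z - - u - u))\<^sup>2)"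
    unfolding shift_dist_def using infsum_shift(1)[of "\<lambda>z. (r z - r (z - u))\<^sup>2" "- u"] by simp
  also have "\<dots> = shift_dist (- u)"
    unfolding shift_dist_def by (simp add: power2_commute)
  finally show ?thesis by simp
qed

text \<open>Two reflections compose to a translation.\<close>
lemma shift_dist_le: "shift_dist (s - t) \<le> 2 * refl_dist s + 2 * refl_dist t"
proof -
  have eq: "t - (s - z) = z - (s - t)" for z by simp
  have "shift_dist (s - t) \<le> (\<Sum>\<^sub>\<infinity>z. 2 * (r z - r (s - z))\<^sup>2 + 2 * (r (s - z) - r (t - (s - z)))\<^sup>2)"
    unfolding shift_dist_def
  proof (intro infsum_mono summable[where u = "s - t" and s = s])
    fix z
    have "(a - c)\<^sup>2 \<le> 2 * (a - b)\<^sup>2 + 2 * (b - c)\<^sup>2" for a b c :: real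
      using sum_squares_bound[of "a - b" "b - c"] by (simp add: power2_eq_square algebra_simps)
    from this[of "r z" "r (t - (s - z))" "r (s - z)"]
    show "(r z - r (z - (s - t)))\<^sup>2 \<le> 2 * (r z - r (s - z))\<^sup>2 + 2 * (r (s - z) - r (t - (s - z)))\<^sup>2"
      by (simp add: eq)
  qed (auto simp: eq)
  also have "\<dots> = (\<Sum>\<^sub>\<infinity>z. 2 * (r z - r (s - z))\<^sup>2) + (\<Sum>\<^sub>\<infinity>z. 2 * (r (s - z) - r (t - (s - z)))\<^sup>2)"
    by (intro infsum_add summable[where u = "s - t" and s = s]) (auto simp: eq)
  also have "(\<Sum>\<^sub>\<infinity>z. 2 * (r (s - z) - r (t - (s - z)))\<^sup>2) = (\<Sum>\<^sub>\<infinity>z. 2 * (r z - r (t - z))\<^sup>2)"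
    by (rule infsum_shift(2)[of "\<lambda>z. 2 * (r z - r (t - z))\<^sup>2"])
  finally show ?thesis
    unfolding refl_dist_def by (simp add: infsum_cmult_right')
qed

section \<open>Mass under approximate translation invariance\<close>

lemma mass_mono: "(\<And>x. Q x \<Longrightarrow> R x) \<Longrightarrow> mass Q \<le> mass R"
  unfolding mass_def by (intro sum_mono mult_left_mono) auto

lemma mass_disj: "mass (\<lambda>x. Q x \<or> R x) \<le> mass Q + mass R"
  unfolding mass_def sum.distrib[symmetric] by (intro sum_mono) (auto simp: of_bool_def)

text \<open>Since a^2 - b^2 = (a - b)(a + b), near invariance of \<open>r\<close> gives near
  invariance of the law \<open>r\<^sup>2\<close>. The weights in Young's inequality are balanced:
  16/256 from the differences and 2/32 from the squares, together 1/8.\<close>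

lemma mass_shift:
  assumes "shift_dist u \<le> 1 / 256"
  shows "mass Q \<le> mass (\<lambda>z. Q (z + u)) + 1 / 8"
proof -
  have "mass Q = (\<Sum>\<^sub>\<infinity>z. (r z)\<^sup>2 * of_bool (Q z))"
    unfolding mass_def by (subst infsum_support) auto
  also have "\<dots> \<le> (\<Sum>\<^sub>\<infinity>z. (r (z - u))\<^sup>2 * of_bool (Q z) +
                  (16 * (r z - r (z - u))\<^sup>2 + ((r z)\<^sup>2 + (r (z - u))\<^sup>2) / 32))"
  proof (intro infsum_mono summable[where u = u and s = 0])
    fix z
    have "a\<^sup>2 \<le> b\<^sup>2 + (16 * (a - b)\<^sup>2 + (a\<^sup>2 + b\<^sup>2) / 32)" for a b :: real
    proof -
      have "0 \<le> (4 * (a - b) - (a + b) / 8)\<^sup>2 + (a - b)\<^sup>2 / 64" by simp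
      also have "\<dots> = 16 * (a - b)\<^sup>2 + (a\<^sup>2 + b\<^sup>2) / 32 + b\<^sup>2 - a\<^sup>2"
        by (simp add: power2_eq_square field_simps)
      finally show ?thesis by simp
    qed
    from this[of "r z" "r (z - u)"]
    show "(r z)\<^sup>2 * of_bool (Q z) \<le> (r (z - u))\<^sup>2 * of_bool (Q z) +
                  (16 * (r z - r (z - u))\<^sup>2 + ((r z)\<^sup>2 + (r (z - u))\<^sup>2) / 32)"
      by (auto simp: of_bool_def)
  qed auto
  also have "\<dots> = (\<Sum>\<^sub>\<infinity>z. (r (z - u))\<^sup>2 * of_bool (Q z)) +
       ((\<Sum>\<^sub>\<infinity>z. 16 * (r z - r (z - u))\<^sup>2) + (\<Sum>\<^sub>\<infinity>z. ((r z)\<^sup>2 + (r (z - u))\<^sup>2) / 32))"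
    by (subst infsum_add) (auto intro!: summable[where u = u and s = 0] infsum_add)
  also have "(\<Sum>\<^sub>\<infinity>z. ((r z)\<^sup>2 + (r (z - u))\<^sup>2) / 32) = 1 / 16"
  proof -
    have "(\<Sum>\<^sub>\<infinity>z. (r z)\<^sup>2 + (r (z - u))\<^sup>2) = 2"
      by (subst infsum_add) (auto simp: infsum_sq infsum_sq_shift intro!: summable[where u = u and s = 0])
    then show ?thesis
      using infsum_cmult_left'[of "\<lambda>z. (r z)\<^sup>2 + (r (z - u))\<^sup>2" "1/32" UNIV] by simp
  qed
  also have "(\<Sum>\<^sub>\<infinity>z. 16 * (r z - r (z - u))\<^sup>2) = 16 * shift_dist u"
    unfolding shift_dist_def by (rule infsum_cmult_right')
  also have "(\<Sum>\<^sub>\<infinity>z. (r (z - u))\<^sup>2 * of_bool (Q z)) = mass (\<lambda>z. Q (z + u))"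
  proof -
    have "(\<Sum>\<^sub>\<infinity>z. (r (z - u))\<^sup>2 * of_bool (Q z)) = (\<Sum>\<^sub>\<infinity>z. (r z)\<^sup>2 * of_bool (Q (z + u)))"
      using infsum_shift(1)[of "\<lambda>z. (r z)\<^sup>2 * of_bool (Q (z + u))" u] by simp
    also have "\<dots> = mass (\<lambda>z. Q (z + u))"
      unfolding mass_def by (subst infsum_support) auto
    finally show ?thesis .
  qed
  finally show ?thesis using assms by simp
qed

text \<open>Apply \<open>mass_shift\<close> to the half-space of points with coordinate at most
  \<open>a\<close>. A translate of it is the half-space below the window, so the window carries the
  difference of their masses.\<close>

lemma mass_window:
  assumes "shift_dist u \<le> 1 / 256"
  shows "mass (\<lambda>z. a - \<bar>coord j u\<bar> < coord j z \<and> coord j z \<le> a) \<le> 1 / 8"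
proof -
  define v where "v = (if coord j u \<ge> 0 then u else - u)"
  have v: "coord j v = \<bar>coord j u\<bar>" "shift_dist v \<le> 1 / 256"
    using assms by (auto simp: v_def shift_dist_uminus coord_uminus)
  have "mass (\<lambda>z. coord j z \<le> a) = mass (\<lambda>z. a - coord j v < coord j z \<and> coord j z \<le> a) + mass (\<lambda>z. coord j z \<le> a - coord j v)"
    unfolding mass_def sum.distrib[symmetric]
    by (intro sum.cong) (use v(1) in \<open>auto simp: of_bool_def\<close>)
  moreover have "mass (\<lambda>z. coord j z \<le> a) \<le> mass (\<lambda>z. coord j z \<le> a - coord j v) + 1 / 8"
    using mass_shift[OF v(2), of "\<lambda>z. coord j z \<le> a"] by (simp add: coord_add algebra_simps)
  ultimately show ?thesis using v(1) by simp
qed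

lemma approximate_periods_trivial:
  assumes large: "mass (\<lambda>x. shift_dist (x - x0) \<le> 1 / 256) \<ge> 1 / 2"
    and x: "x \<in> X" "shift_dist (x - x0) \<le> 1 / 256"
  shows "x = x0"
proof (rule ccontr)
  assume "x \<noteq> x0"
  then obtain j where j: "coord j x \<noteq> coord j x0" using coord_eqI by blast
  define P where "P = {x \<in> X. shift_dist (x - x0) \<le> 1 / 256}"
  have "finite P" "P \<noteq> {}" using fin x by (auto simp: P_def)
  define f where "f = (\<lambda>z. \<bar>coord j (z - x0)\<bar>)"
  have "Max (f ` P) \<in> f ` P" using \<open>finite P\<close> \<open>P \<noteq> {}\<close> by (intro Max_in) auto
  then obtain y where "y \<in> P" "Max (f ` P) = f y" by auto
  then have y: "y \<in> P" "\<And>z. z \<in> P \<Longrightarrow> \<bar>coord j (z - x0)\<bar> \<le> \<bar>coord j (y - x0)\<bar>"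
    using Max_ge[of "f ` P"] \<open>finite P\<close> by (auto simp: f_def)
  \<comment> \<open>The displacement of the extreme point \<open>y\<close> plays both roles: it
    bounds the spread of \<open>P\<close> in coordinate \<open>j\<close>, and as the coordinate of
    an approximate period it is an admissible window width.\<close>
  define v where "v = \<bar>coord j (y - x0)\<bar>"
  have v: "v > 0" using y(2)[of x] x j by (auto simp: P_def v_def coord_diff)
  have w: "mass (\<lambda>z. a - v < coord j z \<and> coord j z \<le> a) \<le> 1 / 8" for a
    unfolding v_def using y(1) by (intro mass_window) (simp add: P_def)
  have "mass (\<lambda>x. shift_dist (x - x0) \<le> 1 / 256) = mass (\<lambda>x. x \<in> P)"
    unfolding mass_def P_def by (intro sum.cong) auto
  \<comment> \<open>The windows are half-open, so those ending at offsets \<open>v\<close> and 0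
    miss the left endpoint \<open>-v\<close>; hence the third one. Their total mass is at most 3/8,
    below the assumed 1/2.\<close>
  also have "\<dots> \<le> mass (\<lambda>z. (coord j x0 + v - v < coord j z \<and> coord j z \<le> coord j x0 + v) \<or>
     ((coord j x0 - v < coord j z \<and> coord j z \<le> coord j x0) \<or> (coord j x0 - v - v < coord j z \<and> coord j z \<le> coord j x0 - v)))"
  proof (rule mass_mono)
    fix z assume "z \<in> P"
    from y(2)[OF this] v have "\<bar>coord j z - coord j x0\<bar> \<le> v" by (simp add: v_def coord_diff)
    then show "(coord j x0 + v - v < coord j z \<and> coord j z \<le> coord j x0 + v) \<or>
     ((coord j x0 - v < coord j z \<and> coord j z \<le> coord j x0) \<or> (coord j x0 - v - v < coord j z \<and> coord j z \<le> coord j x0 - v))"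
      using v by linarith
  qed
  also have "\<dots> \<le> 1 / 8 + (1 / 8 + 1 / 8)"
    by (intro order_trans[OF mass_disj] add_mono w)
  finally show False using large by simp
qed

text \<open>By \<open>refl_dist_eq\<close> the left side is 1 - D, where D is half the mean
  reflection distance. For small D two averaging steps fix \<open>y0\<close> and then
  \<open>x0\<close>, Markov's inequality makes \<open>x - x0\<close> an approximate period for most
  \<open>x\<close>, and \<open>approximate_periods_trivial\<close> puts that mass on
  \<open>x0\<close> alone.\<close>

lemma concentration:
  assumes le: "\<And>x. x \<in> X \<Longrightarrow> (r x)\<^sup>2 \<le> T"
  shows "(\<Sum>x\<in>X. \<Sum>y\<in>X. (r x)\<^sup>2 * (r y)\<^sup>2 * (\<Sum>z\<in>X. r z * r (x + y - z)))
           \<le> 1 - (1 - T) / 4096"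
proof -
  define D where "D = (\<Sum>y\<in>X. (r y)\<^sup>2 * (\<Sum>x\<in>X. (r x)\<^sup>2 * refl_dist (x + y))) / 2"
  have "(\<Sum>x\<in>X. \<Sum>y\<in>X. (r x)\<^sup>2 * (r y)\<^sup>2 * (\<Sum>z\<in>X. r z * r (x + y - z)))
     = (\<Sum>x\<in>X. \<Sum>y\<in>X. (r x)\<^sup>2 * (r y)\<^sup>2) - (\<Sum>x\<in>X. \<Sum>y\<in>X. (r x)\<^sup>2 * (r y)\<^sup>2 * refl_dist (x + y)) / 2"
    by (simp add: refl_dist_eq sum_subtractf[symmetric] sum_divide_distrib algebra_simps)
  also have "(\<Sum>x\<in>X. \<Sum>y\<in>X. (r x)\<^sup>2 * (r y)\<^sup>2) = 1"
    using unit by (simp flip: sum_product)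
  also have "(\<Sum>x\<in>X. \<Sum>y\<in>X. (r x)\<^sup>2 * (r y)\<^sup>2 * refl_dist (x + y)) / 2 = D"
    unfolding D_def sum_distrib_left by (subst sum.swap) (simp add: mult_ac)
  finally have S: "(\<Sum>x\<in>X. \<Sum>y\<in>X. (r x)\<^sup>2 * (r y)\<^sup>2 * (\<Sum>z\<in>X. r z * r (x + y - z))) = 1 - D" .
  have D0: "D \<ge> 0"
    unfolding D_def by (intro divide_nonneg_nonneg sum_nonneg mult_nonneg_nonneg refl_dist_nonneg) auto
  obtain x1 where "x1 \<in> X" using unit by fastforce
  then have T0: "T \<ge> 0" using le[of x1] by (meson order_trans zero_le_power2)
  have "D \<ge> (1 - T) / 4096"
  proof (cases "D \<ge> 1 / 4096")
    case True
    then show ?thesis using T0 by simp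
  next
    case False
    obtain y0 where y0: "y0 \<in> X" "(\<Sum>x\<in>X. (r x)\<^sup>2 * refl_dist (x + y0)) \<le> 2 * D"
      using exists_le_weighted_average[OF fin _ unit, of "\<lambda>y. \<Sum>x\<in>X. (r x)\<^sup>2 * refl_dist (x + y)" "2 * D"]
      by (auto simp: D_def)
    obtain x0 where x0: "x0 \<in> X" "refl_dist (x0 + y0) \<le> 2 * D"
      using exists_le_weighted_average[OF fin _ unit y0(2)] by auto
    \<comment> \<open>The reflections with parameters \<open>x + y0\<close> and
      \<open>x0 + y0\<close> compose to the translation by \<open>x - x0\<close>. Averaging gives 2
      * 2D + 2 * 2D = 8D.\<close>
    have "(\<Sum>x\<in>X. (r x)\<^sup>2 * shift_dist (x - x0))
        \<le> (\<Sum>x\<in>X. (r x)\<^sup>2 * (2 * refl_dist (x + y0) + 2 * refl_dist (x0 + y0)))"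
      using shift_dist_le[of "_ + y0" "x0 + y0"] by (intro sum_mono mult_left_mono) auto
    also have "\<dots> = 2 * (\<Sum>x\<in>X. (r x)\<^sup>2 * refl_dist (x + y0)) + (\<Sum>x\<in>X. (r x)\<^sup>2) * (2 * refl_dist (x0 + y0))"
      by (simp add: sum.distrib sum_distrib_left sum_distrib_right algebra_simps)
    finally have avg: "(\<Sum>x\<in>X. (r x)\<^sup>2 * shift_dist (x - x0)) \<le> 8 * D"
      using unit x0(2) y0(2) by simp
    \<comment> \<open>Markov's inequality at the threshold 1/256, and 256 * 8 = 2048. The case D <
      1/4096 leaves at least half of the mass.\<close>
    have "1 - mass (\<lambda>x. shift_dist (x - x0) \<le> 1 / 256)
        = (\<Sum>x\<in>X. (r x)\<^sup>2 * (1 - of_bool (shift_dist (x - x0) \<le> 1 / 256)))"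
      by (simp add: mass_def right_diff_distrib sum_subtractf unit)
    also have "\<dots> \<le> (\<Sum>x\<in>X. (r x)\<^sup>2 * (256 * shift_dist (x - x0)))"
      by (intro sum_mono mult_left_mono) (auto simp: of_bool_def shift_dist_nonneg)
    also have "\<dots> \<le> 2048 * D"
      using avg by (simp add: sum_distrib_left mult.left_commute[of _ 256] flip: sum_distrib_left)
    finally have good: "mass (\<lambda>x. shift_dist (x - x0) \<le> 1 / 256) \<ge> 1 - 2048 * D" by simp
    then have "mass (\<lambda>x. shift_dist (x - x0) \<le> 1 / 256) \<ge> 1 / 2" using False by simp
    from approximate_periods_trivial[OF this]
    have "mass (\<lambda>x. shift_dist (x - x0) \<le> 1 / 256) \<le> (\<Sum>x\<in>X. if x = x0 then (r x)\<^sup>2 else 0)"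
      unfolding mass_def by (intro sum_mono) (auto simp: of_bool_def)
    also have "\<dots> \<le> T" using fin x0(1) le by simp
    finally show ?thesis using good D0 by simp
  qed
  then show ?thesis using S by simp
qed

text \<open>With A = r(x) r(y) and B = r(z) r(w) the summand is at most (A^2 B + B^2 A) / 2. The two
  halves have equal sums because the constraint is symmetric, and for fixed x, y, z it determines w,
  which leaves the overlap bounded in \<open>concentration\<close>.\<close>

lemma quadruple_sum_le:
  assumes le: "\<And>x. x \<in> X \<Longrightarrow> (r x)\<^sup>2 \<le> T"
  shows "(\<Sum>x\<in>X. \<Sum>y\<in>X. \<Sum>z\<in>X. \<Sum>w\<in>X.
           of_bool (x + y = z + w) * (r x * r y * (r z * r w)) powr (3 / 2)) \<le> 1 - (1 - T) / 4096"
proof -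
  let ?q = "\<lambda>x y z w. of_bool (x + y = z + w) * ((r x * r y)\<^sup>2 * (r z * r w))"
  have AMGM: "(a * b) powr (3 / 2) \<le> a\<^sup>2 * b / 2 + b\<^sup>2 * a / 2" if "a \<ge> 0" "b \<ge> 0" for a b :: real
  proof (cases "a * b = 0")
    case False
    have "(a * b) powr (3 / 2) = (a * b) powr 1 * (a * b) powr (1 / 2)"
      unfolding powr_add[symmetric] by simp
    also have "\<dots> = (a * b) * sqrt (a * b)"
      using that by (simp add: powr_half_sqrt)
    also have "\<dots> \<le> (a * b) * ((a + b) / 2)"
      using that by (intro mult_left_mono arith_geo_mean_sqrt) auto
    finally show ?thesis by (simp add: power2_eq_square field_simps)
  qed (use that in auto)
  have "(\<Sum>x\<in>X. \<Sum>y\<in>X. \<Sum>z\<in>X. \<Sum>w\<in>X.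
           of_bool (x + y = z + w) * (r x * r y * (r z * r w)) powr (3 / 2))
      \<le> (\<Sum>x\<in>X. \<Sum>y\<in>X. \<Sum>z\<in>X. \<Sum>w\<in>X. ?q x y z w / 2 + ?q z w x y / 2)"
    using AMGM nonneg by (intro sum_mono) (auto simp: of_bool_def)
  also have "\<dots> = (\<Sum>x\<in>X. \<Sum>y\<in>X. \<Sum>z\<in>X. \<Sum>w\<in>X. ?q x y z w) / 2
                + (\<Sum>x\<in>X. \<Sum>y\<in>X. \<Sum>z\<in>X. \<Sum>w\<in>X. ?q z w x y) / 2"
    by (simp add: sum.distrib sum_divide_distrib)
  also have "(\<Sum>x\<in>X. \<Sum>y\<in>X. \<Sum>z\<in>X. \<Sum>w\<in>X. ?q z w x y)
           = (\<Sum>z\<in>X. \<Sum>w\<in>X. \<Sum>x\<in>X. \<Sum>y\<in>X. ?q z w x y)"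
  proof -
    \<comment> \<open>Pairing the variables makes the exchange of (x, y) with (z, w) a single
      \<open>sum.swap\<close>.\<close>
    have pairs: "(\<Sum>x\<in>X. \<Sum>y\<in>X. h x y) = (\<Sum>p\<in>X\<times>X. h (fst p) (snd p))" for h :: "'a \<Rightarrow> 'a \<Rightarrow> real"
      by (simp add: sum.cartesian_product case_prod_unfold)
    have "(\<Sum>x\<in>X. \<Sum>y\<in>X. \<Sum>z\<in>X. \<Sum>w\<in>X. ?q z w x y)
        = (\<Sum>p\<in>X\<times>X. \<Sum>z\<in>X. \<Sum>w\<in>X. ?q z w (fst p) (snd p))"
      by (rule pairs)
    also have "\<dots> = (\<Sum>p\<in>X\<times>X. \<Sum>q\<in>X\<times>X. ?q (fst q) (snd q) (fst p) (snd p))"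
      by (intro sum.cong refl pairs)
    also have "\<dots> = (\<Sum>q\<in>X\<times>X. \<Sum>p\<in>X\<times>X. ?q (fst q) (snd q) (fst p) (snd p))"
      by (rule sum.swap)
    also have "\<dots> = (\<Sum>q\<in>X\<times>X. \<Sum>x\<in>X. \<Sum>y\<in>X. ?q (fst q) (snd q) x y)"
      by (intro sum.cong refl pairs[symmetric])
    also have "\<dots> = (\<Sum>z\<in>X. \<Sum>w\<in>X. \<Sum>x\<in>X. \<Sum>y\<in>X. ?q z w x y)"
      by (rule pairs[symmetric])
    finally show ?thesis .
  qed
  also have "(\<Sum>x\<in>X. \<Sum>y\<in>X. \<Sum>z\<in>X. \<Sum>w\<in>X. ?q x y z w)
     = (\<Sum>x\<in>X. \<Sum>y\<in>X. (r x)\<^sup>2 * (r y)\<^sup>2 * (\<Sum>z\<in>X. r z * r (x + y - z)))"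
  proof (intro sum.cong refl)
    fix x y
    have "(\<Sum>w\<in>X. ?q x y z w) = (r x)\<^sup>2 * (r y)\<^sup>2 * (r z * r (x + y - z))" for z
    proof -
      have "(\<Sum>w\<in>X. ?q x y z w) = (\<Sum>w\<in>X. if w = x + y - z then (r x * r y)\<^sup>2 * (r z * r w) else 0)"
        by (intro sum.cong) (auto simp: of_bool_def algebra_simps)
      also have "\<dots> = (r x)\<^sup>2 * (r y)\<^sup>2 * (r z * r (x + y - z))"
        using fin outside by (auto simp: power_mult_distrib)
      finally show ?thesis .
    qed
    then show "(\<Sum>z\<in>X. \<Sum>w\<in>X. ?q x y z w) = (r x)\<^sup>2 * (r y)\<^sup>2 * (\<Sum>z\<in>X. r z * r (x + y - z))"
      by (simp add: sum_distrib_left)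
  qed
  finally show ?thesis using concentration[OF le] by simp
qed

end

section \<open>Trigonometric polynomials on the torus\<close>

abbreviation circle :: "real measure" where
  "circle \<equiv> restrict_space lborel {0..<1}"

lemma prob_space_circle: "prob_space circle"
  by (intro prob_spaceI) (simp add: emeasure_restrict_space space_restrict_space)

lemma product_circle: "product_sigma_finite (\<lambda>_. circle)"
  unfolding product_sigma_finite_def using prob_space_circle prob_space_imp_sigma_finite by blast

lemma prob_space_torus: "prob_space (torus d)"
  unfolding torus_def by (intro prob_space_PiM prob_space_circle)

lemma integral_circle_exp:
  "(\<integral>t. exp (- 2 * of_real pi * \<i> * of_real (t * of_int k)) \<partial>circle) = of_bool (k = 0)"
proof (cases "k = 0")
  case True
  then show ?thesis
    using prob_space.prob_space[OF prob_space_circle] by simp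
next
  case False
  define c where "c = - 2 * of_real pi * \<i> * of_int k"
  have c: "c \<noteq> 0" using False by (simp add: c_def)
  have ec: "exp c = 1"
    unfolding c_def using exp_eq_1[of c] by (auto simp: c_def intro!: exI[of _ "-k"])
  have "(\<integral>t. exp (- 2 * of_real pi * \<i> * of_real (t * of_int k)) \<partial>circle)
      = (\<integral>t. indicator {0..<1} t *\<^sub>R exp (c * of_real t) \<partial>lborel)"
    by (subst integral_restrict_space) (auto simp: c_def mult_ac)
  \<comment> \<open>The fundamental theorem is applied on a closed interval; the added endpoint is a
    null set.\<close>
  also have "\<dots> = (\<integral>t. indicator {0..1} t *\<^sub>R exp (c * of_real t) \<partial>lborel)"
    using AE_lborel_singleton[of "1::real"]
    by (intro integral_cong_AE) (auto simp: indicator_def elim!: eventually_mono)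
  also have "\<dots> = exp (c * of_real 1) / c - exp (c * of_real 0) / c"
  proof (rule integral_FTC_Icc)
    fix t :: real
    have "((\<lambda>z. exp (c * z) / c) has_field_derivative exp (c * of_real t)) (at (of_real t))"
      using c by (auto intro!: derivative_eq_intros)
    then show "((\<lambda>t. exp (c * of_real t) / c) has_vector_derivative exp (c * of_real t)) (at t within {0..1})"
      by (rule has_vector_derivative_real_field)
  qed (auto intro!: continuous_intros)
  finally show ?thesis using ec False by simp
qed

lemma fourier_mode_eq_prod:
  "fourier_mode d x \<xi> = (\<Prod>j<d. exp (- 2 * of_real pi * \<i> * of_real (\<xi> j * of_int (x j))))"
  unfolding fourier_mode_def of_real_sum sum_distrib_left by (rule exp_sum) simp

lemma fourier_mode_measurable [measurable]: "fourier_mode d x \<in> borel_measurable (torus d)"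
proof -
  have [measurable]: "(\<lambda>\<xi>. \<xi> j) \<in> borel_measurable (torus d)" if "j < d" for j
  proof -
    have "(\<lambda>\<xi>. \<xi> j) \<in> measurable (torus d) circle"
      unfolding torus_def using that by (intro measurable_component_singleton) auto
    then show ?thesis
      by (simp add: measurable_restrict_space2_iff)
  qed
  have "(\<lambda>\<xi>. \<Sum>j<d. \<xi> j * of_int (x j)) \<in> borel_measurable (torus d)" by measurable
  then show ?thesis unfolding fourier_mode_def[abs_def] by measurable
qed

lemma norm_fourier_mode [simp]: "norm (fourier_mode d x \<xi>) = 1"
  by (simp add: fourier_mode_def)

lemma cnj_fourier_mode: "cnj (fourier_mode d x \<xi>) = fourier_mode d (- x) \<xi>"
  by (simp add: fourier_mode_def exp_cnj sum_negf fun_Compl_def)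

lemma fourier_mode_add: "fourier_mode d (x + y) \<xi> = fourier_mode d x \<xi> * fourier_mode d y \<xi>"
  by (simp add: fourier_mode_def ring_distribs sum.distrib flip: exp_add)

text \<open>The integral factorises over the coordinates. Only indices below \<open>d\<close> enter,
  so the formula also covers sums and differences of lattice points, whose other values are sums and
  differences of \<open>undefined\<close>.\<close>

lemma integral_fourier_mode: "(\<integral>\<xi>. fourier_mode d x \<xi> \<partial>torus d) = of_bool (\<forall>j<d. x j = 0)"
proof -
  interpret product_sigma_finite "\<lambda>_::nat. circle" by (rule product_circle)
  have "(\<integral>\<xi>. fourier_mode d x \<xi> \<partial>torus d)
     = (\<Prod>j<d. \<integral>t. exp (- 2 * of_real pi * \<i> * of_real (t * of_int (x j))) \<partial>circle)"
    unfolding fourier_mode_eq_prod torus_def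
  proof (rule product_integral_prod)
    interpret c: prob_space circle by (rule prob_space_circle)
    fix j :: nat
    have "(\<lambda>t. t) \<in> borel_measurable circle" by (rule measurable_restrict_space1) simp
    then have [measurable]: "(\<lambda>t. exp (- 2 * of_real pi * \<i> * of_real (t * of_int (x j)))) \<in> borel_measurable circle"
      by measurable
    show "integrable circle (\<lambda>t. exp (- 2 * of_real pi * \<i> * of_real (t * of_int (x j))))"
    proof (rule c.integrable_const_bound[where B = 1])
      show "(\<lambda>t. exp (- 2 * of_real pi * \<i> * of_real (t * of_int (x j)))) \<in> borel_measurable circle"
        by measurable
    qed simp
  qed simp
  also have "\<dots> = (\<Prod>j<d. of_bool (x j = 0))"
    by (intro prod.cong refl integral_circle_exp)
  also have "\<dots> = of_bool (\<forall>j<d. x j = 0)"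
    by (auto simp: of_bool_def)
  finally show ?thesis .
qed

definition trig_poly :: "nat \<Rightarrow> (nat \<Rightarrow> int) set \<Rightarrow> ((nat \<Rightarrow> int) \<Rightarrow> complex) \<Rightarrow> (nat \<Rightarrow> real) \<Rightarrow> complex" where
  "trig_poly d X a \<xi> = (\<Sum>x\<in>X. fourier_mode d x \<xi> * a x)"

lemma trig_poly_measurable [measurable]: "trig_poly d X a \<in> borel_measurable (torus d)"
  unfolding trig_poly_def[abs_def] by measurable

lemma norm_trig_poly_le: "norm (trig_poly d X a \<xi>) \<le> (\<Sum>x\<in>X. norm (a x))"
  unfolding trig_poly_def by (rule order_trans[OF norm_sum]) (simp add: norm_mult)

lemma integrable_bounded_torus:
  fixes f :: "_ \<Rightarrow> 'b::{banach, second_countable_topology}"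
  assumes "f \<in> borel_measurable (torus d)" "\<And>\<xi>. norm (f \<xi>) \<le> B"
  shows "integrable (torus d) f"
proof -
  interpret prob_space "torus d" by (rule prob_space_torus)
  show ?thesis using assms by (intro integrable_const_bound[where B = B]) auto
qed

lemma integral_norm_trig_poly_2:
  assumes "finite X" "X \<subseteq> int_lattice d"
  shows "(\<integral>\<xi>. (norm (trig_poly d X a \<xi>))\<^sup>2 \<partial>torus d) = (\<Sum>x\<in>X. (norm (a x))\<^sup>2)"
proof -
  have i: "integrable (torus d) (\<lambda>\<xi>. a x * cnj (a y) * fourier_mode d (x - y) \<xi>)" for x y
    by (rule integrable_bounded_torus[where B = "norm (a x * cnj (a y))"]) (auto simp: norm_mult)
  have "complex_of_real (\<integral>\<xi>. (norm (trig_poly d X a \<xi>))\<^sup>2 \<partial>torus d)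
      = (\<integral>\<xi>. trig_poly d X a \<xi> * cnj (trig_poly d X a \<xi>) \<partial>torus d)"
    unfolding integral_complex_of_real[symmetric] complex_norm_square ..
  also have "\<dots> = (\<integral>\<xi>. (\<Sum>x\<in>X. \<Sum>y\<in>X. a x * cnj (a y) * fourier_mode d (x - y) \<xi>) \<partial>torus d)"
    unfolding trig_poly_def
    by (simp add: sum_product cnj_fourier_mode mult_ac diff_conv_add_uminus fourier_mode_add del: add_uminus_conv_diff)
  also have "\<dots> = (\<Sum>x\<in>X. \<Sum>y\<in>X. a x * cnj (a y) * of_bool (\<forall>j<d. (x - y) j = 0))"
    using i by (simp add: Bochner_Integration.integral_sum Bochner_Integration.integrable_sum integral_fourier_mode)
  also have "\<dots> = (\<Sum>x\<in>X. \<Sum>y\<in>X. if y = x then a x * cnj (a y) else 0)"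
  proof (intro sum.cong refl)
    fix x y assume "x \<in> X" "y \<in> X"
    then have "x \<in> int_lattice d" "y \<in> int_lattice d" using assms(2) by auto
    then have "(\<forall>j<d. (x - y) j = 0) \<longleftrightarrow> y = x"
      by (auto simp: int_lattice_def fun_eq_iff PiE_def extensional_def) (metis)
    then show "a x * cnj (a y) * of_bool (\<forall>j<d. (x - y) j = 0) = (if y = x then a x * cnj (a y) else 0)"
      by simp
  qed
  also have "\<dots> = complex_of_real (\<Sum>x\<in>X. (norm (a x))\<^sup>2)"
    unfolding of_real_sum complex_norm_square using assms(1) by simp
  finally show ?thesis using of_real_eq_iff by blast
qed

text \<open>Expand into two factors and two conjugates. Integration keeps exactly the additive
  quadruples, and passing to absolute values discards the phases of \<open>a\<close>.\<close>

lemma integral_norm_trig_poly_4: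
  assumes "finite X" "X \<subseteq> int_lattice d"
  shows "(\<integral>\<xi>. (norm (trig_poly d X a \<xi>)) ^ 4 \<partial>torus d)
     \<le> (\<Sum>x\<in>X. \<Sum>y\<in>X. \<Sum>z\<in>X. \<Sum>w\<in>X. of_bool (x + y = z + w) *
           (norm (a x) * norm (a y) * (norm (a z) * norm (a w))))"
proof -
  let ?c = "\<lambda>x y z w. a x * a y * (cnj (a z) * cnj (a w))"
  have i: "integrable (torus d) (\<lambda>\<xi>. ?c x y z w * fourier_mode d (x + y - (z + w)) \<xi>)" for x y z w
    by (rule integrable_bounded_torus[where B = "norm (?c x y z w)"]) (auto simp: norm_mult)
  have eq: "(\<forall>j<d. (x + y - (z + w)) j = 0) \<longleftrightarrow> x + y = z + w"
    if "x \<in> X" "y \<in> X" "z \<in> X" "w \<in> X" for x y z w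
  proof -
    have "x \<in> int_lattice d" "y \<in> int_lattice d" "z \<in> int_lattice d" "w \<in> int_lattice d"
      using that assms(2) by auto
    \<comment> \<open>Beyond \<open>d\<close> both sides are \<open>undefined + undefined\<close>,
      so agreement below \<open>d\<close> is equality of functions.\<close>
    then have "x j + y j = z j + w j" if "\<not> j < d" for j
      using that by (simp add: int_lattice_def PiE_def extensional_def)
    then show ?thesis by (auto simp: fun_eq_iff)
  qed
  have "complex_of_real (\<integral>\<xi>. (norm (trig_poly d X a \<xi>)) ^ 4 \<partial>torus d)
      = (\<integral>\<xi>. trig_poly d X a \<xi> * trig_poly d X a \<xi> * (cnj (trig_poly d X a \<xi>) * cnj (trig_poly d X a \<xi>)) \<partial>torus d)"
  proof -
    have "complex_of_real (norm z ^ 4) = z * z * (cnj z * cnj z)" for z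
    proof -
      have "complex_of_real (norm z ^ 4) = (of_real ((norm z)\<^sup>2))\<^sup>2"
        by (simp flip: power_mult)
      also have "\<dots> = (z * cnj z)\<^sup>2" by (simp only: complex_norm_square)
      finally show ?thesis by (simp add: power2_eq_square mult_ac)
    qed
    then show ?thesis by (simp flip: integral_complex_of_real)
  qed
  also have "\<dots> = (\<integral>\<xi>. (\<Sum>x\<in>X. \<Sum>y\<in>X. \<Sum>z\<in>X. \<Sum>w\<in>X. ?c x y z w * fourier_mode d (x + y - (z + w)) \<xi>) \<partial>torus d)"
  proof (intro Bochner_Integration.integral_cong refl)
    fix \<xi>
    let ?e = "\<lambda>x. fourier_mode d x \<xi>"
    have "trig_poly d X a \<xi> * trig_poly d X a \<xi> = (\<Sum>x\<in>X. \<Sum>y\<in>X. ?e x * a x * (?e y * a y))"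
      unfolding trig_poly_def by (simp add: sum_product)
    moreover have "cnj (trig_poly d X a \<xi>) * cnj (trig_poly d X a \<xi>)
        = (\<Sum>z\<in>X. \<Sum>w\<in>X. ?e (- z) * cnj (a z) * (?e (- w) * cnj (a w)))"
      unfolding trig_poly_def by (simp add: sum_product cnj_fourier_mode)
    moreover have "(\<Sum>x\<in>X. \<Sum>y\<in>X. f x y) * (\<Sum>z\<in>X. \<Sum>w\<in>X. g z w)
        = (\<Sum>x\<in>X. \<Sum>y\<in>X. \<Sum>z\<in>X. \<Sum>w\<in>X. f x y * g z w)" for f g :: "_ \<Rightarrow> _ \<Rightarrow> complex"
      unfolding sum_distrib_right unfolding sum_distrib_left ..
    ultimately have "trig_poly d X a \<xi> * trig_poly d X a \<xi> * (cnj (trig_poly d X a \<xi>) * cnj (trig_poly d X a \<xi>))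
        = (\<Sum>x\<in>X. \<Sum>y\<in>X. \<Sum>z\<in>X. \<Sum>w\<in>X. ?e x * a x * (?e y * a y) * (?e (- z) * cnj (a z) * (?e (- w) * cnj (a w))))"
      by simp
    also have "\<dots> = (\<Sum>x\<in>X. \<Sum>y\<in>X. \<Sum>z\<in>X. \<Sum>w\<in>X. ?c x y z w * ?e (x + y - (z + w)))"
    proof (intro sum.cong refl)
      fix x y z w :: "nat \<Rightarrow> int"
      have "x + y - (z + w) = x + y + (- z + - w)" by (simp add: fun_eq_iff)
      then show "?e x * a x * (?e y * a y) * (?e (- z) * cnj (a z) * (?e (- w) * cnj (a w)))
          = ?c x y z w * ?e (x + y - (z + w))"
        by (simp only: fourier_mode_add mult_ac)
    qed
    finally show "trig_poly d X a \<xi> * trig_poly d X a \<xi> * (cnj (trig_poly d X a \<xi>) * cnj (trig_poly d X a \<xi>))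
        = (\<Sum>x\<in>X. \<Sum>y\<in>X. \<Sum>z\<in>X. \<Sum>w\<in>X. ?c x y z w * ?e (x + y - (z + w)))" .
  qed
  also have "\<dots> = (\<Sum>x\<in>X. \<Sum>y\<in>X. \<Sum>z\<in>X. \<Sum>w\<in>X. ?c x y z w * of_bool (\<forall>j<d. (x + y - (z + w)) j = 0))"
    using i by (simp only: Bochner_Integration.integral_sum Bochner_Integration.integrable_sum
                  integral_mult_right_zero integral_fourier_mode)
  also have "\<dots> = (\<Sum>x\<in>X. \<Sum>y\<in>X. \<Sum>z\<in>X. \<Sum>w\<in>X. ?c x y z w * of_bool (x + y = z + w))"
    by (intro sum.cong refl) (simp only: eq)
  finally have "(\<integral>\<xi>. (norm (trig_poly d X a \<xi>)) ^ 4 \<partial>torus d)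
     = Re (\<Sum>x\<in>X. \<Sum>y\<in>X. \<Sum>z\<in>X. \<Sum>w\<in>X. ?c x y z w * of_bool (x + y = z + w))"
    by (metis Re_complex_of_real)
  also have "\<dots> \<le> (\<Sum>x\<in>X. \<Sum>y\<in>X. \<Sum>z\<in>X. \<Sum>w\<in>X. of_bool (x + y = z + w) *
           (norm (a x) * norm (a y) * (norm (a z) * norm (a w))))"
    unfolding Re_sum
  proof (intro sum_mono)
    fix x y z w
    have "Re (?c x y z w * of_bool (x + y = z + w)) \<le> norm (?c x y z w * of_bool (x + y = z + w))"
      by (rule complex_Re_le_cmod)
    also have "\<dots> = of_bool (x + y = z + w) * (norm (a x) * norm (a y) * (norm (a z) * norm (a w)))"
      by (simp add: norm_mult of_bool_def)
    finally show "Re (?c x y z w * of_bool (x + y = z + w))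
       \<le> of_bool (x + y = z + w) * (norm (a x) * norm (a y) * (norm (a z) * norm (a w)))" .
  qed
  finally show ?thesis .
qed

lemma integral_norm_trig_poly_4_le:
  assumes X: "finite X" "X \<subseteq> int_lattice d"
    and unit: "(\<Sum>x\<in>X. norm (a x) powr (4/3)) = 1"
    and le: "\<And>x. x \<in> X \<Longrightarrow> norm (a x) powr (4/3) \<le> T"
  shows "(\<integral>\<xi>. (norm (trig_poly d X a \<xi>)) ^ 4 \<partial>torus d) \<le> 1 - (1 - T) / 4096"
proof -
  \<comment> \<open>The exponent 2/3 makes \<open>r\<^sup>2\<close> the normalised law |a|^(4/3),
    while r^(3/2) = |a| matches the summand of \<open>quadruple_sum_le\<close>.\<close>
  define r where "r = (\<lambda>x. if x \<in> X then norm (a x) powr (2/3) else 0)"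
  have r2: "(r x)\<^sup>2 = norm (a x) powr (4/3)" if "x \<in> X" for x
    using that by (simp add: r_def power2_eq_square flip: powr_add)
  interpret unit_weight X r "\<lambda>j x. x j"
  proof
    show "(\<Sum>x\<in>X. (r x)\<^sup>2) = 1" using unit r2 by simp
  qed (use X in \<open>auto simp: r_def fun_eq_iff\<close>)
  have r32: "r x powr (3/2) = norm (a x)" if "x \<in> X" for x
    using that by (simp add: r_def powr_powr)
  have "(\<Sum>x\<in>X. \<Sum>y\<in>X. \<Sum>z\<in>X. \<Sum>w\<in>X. of_bool (x + y = z + w) *
           (norm (a x) * norm (a y) * (norm (a z) * norm (a w))))
     = (\<Sum>x\<in>X. \<Sum>y\<in>X. \<Sum>z\<in>X. \<Sum>w\<in>X.
           of_bool (x + y = z + w) * (r x * r y * (r z * r w)) powr (3 / 2))"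
    by (intro sum.cong refl) (simp add: powr_mult nonneg r32)
  also have "\<dots> \<le> 1 - (1 - T) / 4096"
    by (rule quadruple_sum_le) (simp add: r2 le)
  finally show ?thesis using integral_norm_trig_poly_4[OF X, of a] by simp
qed

section \<open>Interpolation\<close>

text \<open>The Hadamard three lines theorem with both edge bounds equal to 1. A Gaussian factor
  makes the function small at large height, and the maximum principle applies on a rectangle.
  Arguing by contradiction fixes the damping, so no limit of vanishing damping is taken.\<close>

lemma norm_le_one_in_strip:
  fixes G :: "complex \<Rightarrow> complex"
  assumes hol: "G holomorphic_on UNIV"
    and bounded: "\<And>z. 0 \<le> Re z \<Longrightarrow> Re z \<le> 1 \<Longrightarrow> norm (G z) \<le> B"
    and edges: "\<And>z. Re z = 0 \<or> Re z = 1 \<Longrightarrow> norm (G z) \<le> 1"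
    and z: "0 \<le> Re z" "Re z \<le> 1" "Im z = 0"
  shows "norm (G z) \<le> 1"
proof (rule ccontr)
  assume big: "\<not> norm (G z) \<le> 1"
  \<comment> \<open>With this choice |G(z)| = exp(2 \<epsilon>), while the Gaussian factor at the
    real point \<open>z\<close> costs at most exp(-\<epsilon>), so the damped value still exceeds
    1.\<close>
  define \<epsilon> where "\<epsilon> = ln (norm (G z)) / 2"
  have \<epsilon>: "\<epsilon> > 0" using ln_gt_zero[of "norm (G z)"] big by (simp add: \<epsilon>_def)
  have B: "B \<ge> 0" using order_trans[OF norm_ge_zero bounded[of 0]] by simp
  \<comment> \<open>Large enough for the horizontal sides: exp(\<epsilon> Y^2) \<ge> \<epsilon> Y^2
    \<ge> \<epsilon> Y \<ge> B.\<close>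
  define Y where "Y = 1 + B / \<epsilon>"
  have Y: "Y \<ge> 1" using B \<epsilon> by (simp add: Y_def)
  have "B \<le> \<epsilon> * Y" using \<epsilon> by (simp add: Y_def field_simps)
  also have "\<dots> \<le> \<epsilon> * Y\<^sup>2" using \<epsilon> Y by (simp add: power2_eq_square)
  also have "\<dots> \<le> exp (\<epsilon> * Y\<^sup>2)" using exp_ge_add_one_self[of "\<epsilon> * Y\<^sup>2"] by linarith
  finally have BY: "B * exp (- (\<epsilon> * Y\<^sup>2)) \<le> 1" by (simp add: exp_minus field_simps)
  define H where "H = (\<lambda>w. G w * exp (of_real \<epsilon> * (w\<^sup>2 - 1)))"
  have holH: "H holomorphic_on UNIV"
    unfolding H_def using hol by (intro holomorphic_intros)
  have Hle: "norm (H w) \<le> norm (G w) * exp (- (\<epsilon> * (Im w)\<^sup>2))" if "0 \<le> Re w" "Re w \<le> 1" for w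
  proof -
    have "(Re w)\<^sup>2 \<le> 1" using that by (simp add: power_le_one)
    then have "\<epsilon> * ((Re w)\<^sup>2 - (Im w)\<^sup>2 - 1) \<le> - (\<epsilon> * (Im w)\<^sup>2)"
      using \<epsilon> by (simp add: algebra_simps)
    then show ?thesis
      unfolding H_def norm_mult norm_exp_eq_Re by (intro mult_left_mono) (simp_all add: Re_power2)
  qed
  define S where "S = cbox (Complex 0 (- Y)) (Complex 1 Y)"
  have "norm (H z) \<le> 1"
  proof (rule maximum_modulus_frontier[of H S])
    show "H holomorphic_on interior S" "continuous_on (closure S) H"
      using holH holomorphic_on_subset holomorphic_on_imp_continuous_on by (blast, blast)
    show "bounded S" unfolding S_def by (rule bounded_cbox)
    show "z \<in> S" using z Y by (simp add: S_def in_cbox_complex_iff)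
  next
    fix w assume "w \<in> frontier S"
    then have w: "w \<in> S" "w \<notin> box (Complex 0 (- Y)) (Complex 1 Y)"
      by (auto simp: frontier_def S_def)
    then have re: "0 \<le> Re w" "Re w \<le> 1" by (auto simp: S_def in_cbox_complex_iff)
    from w consider "Re w = 0 \<or> Re w = 1" | "Im w = Y \<or> Im w = - Y"
      by (fastforce simp: S_def in_cbox_complex_iff in_box_complex_iff)
    then show "norm (H w) \<le> 1"
    proof cases
      case 1
      have "norm (H w) \<le> norm (G w) * exp (- (\<epsilon> * (Im w)\<^sup>2))" by (rule Hle[OF re])
      also have "\<dots> \<le> 1 * 1" using edges[OF 1] \<epsilon> by (intro mult_mono) auto
      finally show ?thesis by simp
    next
      case 2
      have "norm (H w) \<le> norm (G w) * exp (- (\<epsilon> * (Im w)\<^sup>2))" by (rule Hle[OF re])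
      also have "\<dots> \<le> B * exp (- (\<epsilon> * Y\<^sup>2))"
        using bounded[OF re] 2 B by (intro mult_mono) auto
      finally show ?thesis using BY by simp
    qed
  qed
  moreover have "norm (H z) = norm (G z) * exp (\<epsilon> * ((Re z)\<^sup>2 - 1))"
    unfolding H_def norm_mult norm_exp_eq_Re using z by (simp add: Re_power2)
  moreover have "norm (G z) = exp (2 * \<epsilon>)"
  proof -
    have "norm (G z) > 0" using big by linarith
    then show ?thesis by (simp add: \<epsilon>_def)
  qed
  ultimately have "2 * \<epsilon> + \<epsilon> * ((Re z)\<^sup>2 - 1) \<le> 0"
    by (simp flip: exp_add)
  moreover have "\<epsilon> * (Re z)\<^sup>2 \<ge> 0" using \<epsilon> by simp
  ultimately show False using \<epsilon> by (simp add: algebra_simps)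
qed

text \<open>An exponential sum with real frequencies is entire and bounded on the strip, so the
  three lines argument applies without a growth condition.\<close>

lemma three_lines_exp_sum:
  fixes c :: "'i \<Rightarrow> complex" and r :: "'i \<Rightarrow> real" and I :: "'i set"
  defines "F \<equiv> \<lambda>z. \<Sum>i\<in>I. c i * exp (of_real (r i) * z)"
  assumes K: "K0 > 0" "K1 > 0" and \<theta>: "0 \<le> \<theta>" "\<theta> \<le> 1"
    and left: "\<And>z. Re z = 0 \<Longrightarrow> norm (F z) \<le> K0"
    and right: "\<And>z. Re z = 1 \<Longrightarrow> norm (F z) \<le> K1"
  shows "norm (F (of_real \<theta>)) \<le> K0 powr (1 - \<theta>) * K1 powr \<theta>"
proof -
  \<comment> \<open>The factor is \<open>K0\<close> to the power z - 1 times \<open>K1\<close> to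
    the power -z; it normalises both edge bounds to 1.\<close>
  define G where "G = (\<lambda>z. F z * exp (of_real (ln K0) * (z - 1) - of_real (ln K1) * z))"
  have normG: "norm (G z) = norm (F z) * exp (ln K0 * (Re z - 1) - ln K1 * Re z)" for z
    unfolding G_def norm_mult norm_exp_eq_Re by simp
  have "norm (G (of_real \<theta>)) \<le> 1"
  proof (rule norm_le_one_in_strip[where G = G])
    show "G holomorphic_on UNIV"
      unfolding G_def F_def by (intro holomorphic_intros)
    show "norm (G z) \<le> (\<Sum>i\<in>I. norm (c i) * exp \<bar>r i\<bar>) * exp (\<bar>ln K0\<bar> + \<bar>ln K1\<bar>)"
      if z: "0 \<le> Re z" "Re z \<le> 1" for z
      unfolding normG
    proof (intro mult_mono)
      show "norm (F z) \<le> (\<Sum>i\<in>I. norm (c i) * exp \<bar>r i\<bar>)"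
        unfolding F_def
      proof (rule order_trans[OF norm_sum], intro sum_mono)
        fix i
        have "r i * Re z \<le> \<bar>r i\<bar> * Re z" using z by (intro mult_right_mono) auto
        also have "\<dots> \<le> \<bar>r i\<bar>" using z by (simp add: mult_left_le)
        finally show "norm (c i * exp (of_real (r i) * z)) \<le> norm (c i) * exp \<bar>r i\<bar>"
          by (simp add: norm_mult mult_left_mono)
      qed
      have "\<bar>ln K0 * (Re z - 1)\<bar> \<le> \<bar>ln K0\<bar>" "\<bar>ln K1 * Re z\<bar> \<le> \<bar>ln K1\<bar>"
        using z by (auto simp: abs_mult mult_left_le)
      then show "exp (ln K0 * (Re z - 1) - ln K1 * Re z) \<le> exp (\<bar>ln K0\<bar> + \<bar>ln K1\<bar>)" by simp
    qed (auto intro: sum_nonneg)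
    show "norm (G z) \<le> 1" if "Re z = 0 \<or> Re z = 1" for z
      unfolding normG using that left[of z] right[of z] K
      by (elim disjE) (simp_all add: exp_minus field_simps)
  qed (use \<theta> in auto)
  then have "norm (F (of_real \<theta>)) \<le> exp (ln K0 * (1 - \<theta>) + ln K1 * \<theta>)"
    by (simp add: normG exp_diff exp_add exp_minus algebra_simps divide_simps)
  then show ?thesis using K by (simp add: powr_def exp_add mult.commute)
qed

text \<open>The analytic power of complex interpolation: the phase of \<open>w\<close> is kept and
  only the modulus is raised to \<open>s\<close>, which is entire in \<open>s\<close>. Since
  \<open>sgn 0 = 0\<close>, the value of the logarithm at 0 does no harm.\<close>

definition cpow :: "complex \<Rightarrow> complex \<Rightarrow> complex" where
  "cpow s w = sgn w * exp (s * of_real (ln (norm w)))"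

lemma norm_cpow: "norm (cpow s w) = norm w powr Re s"
  by (auto simp: cpow_def norm_mult norm_sgn powr_def)

lemma cpow_one: "cpow 1 w = w"
  by (cases "w = 0") (auto simp: cpow_def sgn_div_norm exp_of_real scaleR_conv_of_real of_real_inverse)

lemma integrable_trig_poly_simple:
  assumes "simple_function (torus d) h"
  shows "integrable (torus d) (\<lambda>\<xi>. trig_poly d X b \<xi> * h \<xi>)"
    and "integrable (torus d) (\<lambda>\<xi>. norm (h \<xi>) powr q)"
    and "integrable (torus d) (\<lambda>\<xi>. norm (trig_poly d X b \<xi>) ^ n)"
proof -
  interpret prob_space "torus d" by (rule prob_space_torus)
  have [measurable]: "h \<in> borel_measurable (torus d)"
    using assms by (rule borel_measurable_simple_function)
  have fin: "finite (h ` space (torus d))" using assms by (rule simple_functionD)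
  define H where "H = (\<Sum>w\<in>h ` space (torus d). norm w)"
  have H: "norm (h \<xi>) \<le> H" if "\<xi> \<in> space (torus d)" for \<xi>
    unfolding H_def using fin that by (intro member_le_sum[of _ _ norm]) auto
  show "integrable (torus d) (\<lambda>\<xi>. trig_poly d X b \<xi> * h \<xi>)"
    using H by (intro integrable_const_bound[where B = "(\<Sum>x\<in>X. norm (b x)) * H"])
      (auto simp: norm_mult intro!: mult_mono norm_trig_poly_le sum_nonneg AE_I2)
  define P where "P = (\<Sum>w\<in>h ` space (torus d). norm w powr q)"
  have P: "norm (h \<xi>) powr q \<le> P" if "\<xi> \<in> space (torus d)" for \<xi>
    unfolding P_def using fin that by (intro member_le_sum[of _ _ "\<lambda>w. norm w powr q"]) auto
  then show "integrable (torus d) (\<lambda>\<xi>. norm (h \<xi>) powr q)"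
    by (intro integrable_const_bound[where B = P]) (auto intro!: AE_I2)
  show "integrable (torus d) (\<lambda>\<xi>. norm (trig_poly d X b \<xi>) ^ n)"
    by (intro integrable_bounded_torus[where B = "(\<Sum>x\<in>X. norm (b x)) ^ n"])
      (auto intro!: power_mono norm_trig_poly_le)
qed

text \<open>Riesz--Thorin for a single pair of functions: on the edges of the strip the analytic families
  through \<open>a\<close> and \<open>g\<close> have the moduli prescribed in the last two hypotheses.\<close>
lemma trig_poly_interpolation:
  assumes X: "finite X" and g: "simple_function (torus d) g"
    and K: "K0 > 0" "K1 > 0" and \<theta>: "0 \<le> \<theta>" "\<theta> \<le> 1"
    and p: "p > 0" "p0 > 0" "p1 > 0" "1 / p = (1 - \<theta>) / p0 + \<theta> / p1"
    and left: "\<And>b h. simple_function (torus d) h \<Longrightarrow>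
        (\<And>x. norm (b x) powr p0 = norm (a x) powr p) \<Longrightarrow>
        (\<And>\<xi>. norm (h \<xi>) powr p0 = norm (g \<xi>) powr p) \<Longrightarrow>
        norm (\<integral>\<xi>. trig_poly d X b \<xi> * h \<xi> \<partial>torus d) \<le> K0"
    and right: "\<And>b h. simple_function (torus d) h \<Longrightarrow>
        (\<And>x. norm (b x) powr p1 = norm (a x) powr p) \<Longrightarrow>
        (\<And>\<xi>. norm (h \<xi>) powr p1 = norm (g \<xi>) powr p) \<Longrightarrow>
        norm (\<integral>\<xi>. trig_poly d X b \<xi> * h \<xi> \<partial>torus d) \<le> K1"
  shows "norm (\<integral>\<xi>. trig_poly d X a \<xi> * g \<xi> \<partial>torus d) \<le> K0 powr (1 - \<theta>) * K1 powr \<theta>"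
proof -
  define M where "M = torus d"
  \<comment> \<open>The exponent is affine with real parts p/p0 and p/p1 on the two edges, so there
    the families have the moduli that \<open>left\<close> and \<open>right\<close> prescribe; the
    condition on 1/p gives the value 1 at \<theta>.\<close>
  define s :: "complex \<Rightarrow> complex" where "s = (\<lambda>z. of_real (p / p0) + of_real (p / p1 - p / p0) * z)"
  define V where "V = g ` space M"
  define A where "A = (\<lambda>x v. \<integral>\<xi>. fourier_mode d x \<xi> * indicator (g -` {v} \<inter> space M) \<xi> \<partial>M)"
  define F where "F = (\<lambda>z. \<integral>\<xi>. trig_poly d X (\<lambda>x. cpow (s z) (a x)) \<xi> * cpow (s z) (g \<xi>) \<partial>M)"
  define c :: "(nat \<Rightarrow> int) \<times> complex \<Rightarrow> complex" where "c = (\<lambda>(x, v). sgn (a x) * sgn v * A x v *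
      exp (of_real (p / p0) * of_real (ln (norm (a x)) + ln (norm v))))"
  define r :: "(nat \<Rightarrow> int) \<times> complex \<Rightarrow> real" where "r = (\<lambda>(x, v). (p / p1 - p / p0) * (ln (norm (a x)) + ln (norm v)))"
  have V: "finite V" using g unfolding V_def M_def by (rule simple_functionD)
  have [measurable]: "g -` {v} \<inter> space M \<in> sets M" for v
    using g unfolding M_def by (rule simple_functionD)
  have [measurable]: "fourier_mode d x \<in> borel_measurable M" for x
    unfolding M_def by (rule fourier_mode_measurable)
  have int: "integrable M (\<lambda>\<xi>. fourier_mode d x \<xi> * indicator (g -` {v} \<inter> space M) \<xi>)" for x v
    unfolding M_def
  proof (rule integrable_bounded_torus[where B = 1])
    have "(\<lambda>\<xi>. fourier_mode d x \<xi> * indicator (g -` {v} \<inter> space M) \<xi>) \<in> borel_measurable M"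
      by measurable
    then show "(\<lambda>\<xi>. fourier_mode d x \<xi> * indicator (g -` {v} \<inter> space (torus d)) \<xi>) \<in> borel_measurable (torus d)"
      by (simp add: M_def)
  qed (auto simp: norm_mult indicator_def)
  \<comment> \<open>Splitting the torus into the finitely many level sets of \<open>g\<close> takes
    the dependence on \<open>z\<close> out of the integral and leaves an exponential sum.\<close>
  have F_eq: "F z = (\<Sum>i\<in>X \<times> V. c i * exp (of_real (r i) * z))" for z
  proof -
    have "F z = (\<integral>\<xi>. (\<Sum>x\<in>X. \<Sum>v\<in>V. (cpow (s z) (a x) * cpow (s z) v) *
         (fourier_mode d x \<xi> * indicator (g -` {v} \<inter> space M) \<xi>)) \<partial>M)"
      unfolding F_def
    proof (intro Bochner_Integration.integral_cong refl)
      fix \<xi> assume \<xi>: "\<xi> \<in> space M"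
      have "(\<Sum>v\<in>V. cpow (s z) v * indicator (g -` {v} \<inter> space M) \<xi>)
          = (\<Sum>v\<in>V. if v = g \<xi> then cpow (s z) v else 0)"
        using \<xi> by (intro sum.cong) (auto simp: indicator_def)
      also have "\<dots> = cpow (s z) (g \<xi>)" using V \<xi> by (simp add: V_def)
      finally have *: "cpow (s z) (g \<xi>) = (\<Sum>v\<in>V. cpow (s z) v * indicator (g -` {v} \<inter> space M) \<xi>)" ..
      show "trig_poly d X (\<lambda>x. cpow (s z) (a x)) \<xi> * cpow (s z) (g \<xi>) =
        (\<Sum>x\<in>X. \<Sum>v\<in>V. (cpow (s z) (a x) * cpow (s z) v) *
         (fourier_mode d x \<xi> * indicator (g -` {v} \<inter> space M) \<xi>))"
        unfolding * trig_poly_def sum_product by (intro sum.cong refl) (simp add: mult_ac)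
    qed
    also have "\<dots> = (\<Sum>x\<in>X. \<Sum>v\<in>V. (cpow (s z) (a x) * cpow (s z) v) * A x v)"
      using int by (simp add: A_def Bochner_Integration.integral_sum Bochner_Integration.integrable_sum)
    also have "\<dots> = (\<Sum>(x, v)\<in>X \<times> V. (cpow (s z) (a x) * cpow (s z) v) * A x v)"
      by (rule sum.cartesian_product)
    also have "\<dots> = (\<Sum>i\<in>X \<times> V. c i * exp (of_real (r i) * z))"
    proof (intro sum.cong refl)
      fix i :: "(nat \<Rightarrow> int) \<times> complex"
      obtain x v where i: "i = (x, v)" by force
      have "exp (s z * of_real (ln (norm (a x)))) * exp (s z * of_real (ln (norm v)))
         = exp (of_real (p / p0) * of_real (ln (norm (a x)) + ln (norm v))) * exp (of_real (r i) * z)"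
        unfolding exp_add[symmetric] s_def i r_def by (simp add: algebra_simps)
      then show "(case i of (x, v) \<Rightarrow> cpow (s z) (a x) * cpow (s z) v * A x v) = c i * exp (of_real (r i) * z)"
        unfolding i c_def cpow_def by (simp add: mult_ac)
    qed
    finally show ?thesis .
  qed
  have simple: "simple_function (torus d) (\<lambda>\<xi>. cpow (s z) (g \<xi>))" for z
    using simple_function_compose[OF g, of "cpow (s z)"] by (simp add: comp_def)
  have "norm (F (of_real \<theta>)) \<le> K0 powr (1 - \<theta>) * K1 powr \<theta>"
    unfolding F_eq
  proof (rule three_lines_exp_sum[OF K \<theta>])
    fix z :: complex assume z: "Re z = 0"
    show "norm (\<Sum>i\<in>X \<times> V. c i * exp (of_real (r i) * z)) \<le> K0"
      unfolding F_eq[symmetric] F_def M_def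
      by (rule left[OF simple]) (use p z in \<open>simp_all add: norm_cpow powr_powr s_def\<close>)
  next
    fix z :: complex assume z: "Re z = 1"
    show "norm (\<Sum>i\<in>X \<times> V. c i * exp (of_real (r i) * z)) \<le> K1"
      unfolding F_eq[symmetric] F_def M_def
      by (rule right[OF simple]) (use p z in \<open>simp_all add: norm_cpow powr_powr s_def\<close>)
  qed
  moreover have "s (of_real \<theta>) = 1"
  proof -
    have "p / p0 + (p / p1 - p / p0) * \<theta> = p * ((1 - \<theta>) / p0 + \<theta> / p1)"
      by (simp add: algebra_simps diff_divide_distrib)
    also have "\<dots> = 1" using p by (simp flip: p(4))
    finally show ?thesis
      unfolding s_def of_real_mult[symmetric] of_real_add[symmetric] by simp
  qed
  ultimately show ?thesis by (simp add: F_def cpow_one M_def)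
qed

section \<open>Pairings at the edge exponents 1, 2 and 4/3, and between them\<close>

lemma trig_poly_pairing_1:
  assumes "simple_function (torus d) h" "(\<Sum>x\<in>X. norm (b x)) \<le> 1" "(\<integral>\<xi>. norm (h \<xi>) \<partial>torus d) \<le> 1"
  shows "norm (\<integral>\<xi>. trig_poly d X b \<xi> * h \<xi> \<partial>torus d) \<le> 1"
proof -
  note int = integrable_trig_poly_simple[OF assms(1)]
  have "norm (\<integral>\<xi>. trig_poly d X b \<xi> * h \<xi> \<partial>torus d) \<le> (\<integral>\<xi>. norm (trig_poly d X b \<xi> * h \<xi>) \<partial>torus d)"
    by (rule integral_norm_bound)
  also have "\<dots> \<le> (\<integral>\<xi>. norm (h \<xi>) \<partial>torus d)"
  proof (rule integral_mono)
    fix \<xi>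
    have "norm (trig_poly d X b \<xi>) \<le> 1" using norm_trig_poly_le assms(2) by (rule order_trans)
    then show "norm (trig_poly d X b \<xi> * h \<xi>) \<le> norm (h \<xi>)"
      by (simp add: norm_mult mult_left_le_one_le)
  qed (use int(1) int(2)[of 1] in auto)
  finally show ?thesis using assms(3) by simp
qed

text \<open>Hoelder's inequality, obtained by integrating Young's inequality for |P| / K and |h|,
  where P is the trigonometric polynomial. The exponent \<open>n\<close> is natural because
  orthogonality computes the powers 2 and 4.\<close>

lemma trig_poly_pairing_Hoelder:
  assumes h: "simple_function (torus d) h" and n: "n > 1" and "1 / real n + 1 / q = 1" and q: "q > 1"
    and "K > 0" "(\<integral>\<xi>. norm (trig_poly d X b \<xi>) ^ n \<partial>torus d) \<le> K ^ n"
    and "(\<integral>\<xi>. norm (h \<xi>) powr q \<partial>torus d) \<le> 1"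
  shows "norm (\<integral>\<xi>. trig_poly d X b \<xi> * h \<xi> \<partial>torus d) \<le> K"
proof -
  note int = integrable_trig_poly_simple[OF h]
  have "norm (\<integral>\<xi>. trig_poly d X b \<xi> * h \<xi> \<partial>torus d) \<le> (\<integral>\<xi>. norm (trig_poly d X b \<xi> * h \<xi>) \<partial>torus d)"
    by (rule integral_norm_bound)
  also have "\<dots> \<le> (\<integral>\<xi>. K / (K ^ n * n) * norm (trig_poly d X b \<xi>) ^ n + K / q * norm (h \<xi>) powr q \<partial>torus d)"
  proof (rule integral_mono)
    fix \<xi>
    have "norm (trig_poly d X b \<xi>) / K * norm (h \<xi>)
        \<le> (norm (trig_poly d X b \<xi>) / K) powr n / n + norm (h \<xi>) powr q / q"
      using assms by (intro Youngs_inequality) auto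
    also have "(norm (trig_poly d X b \<xi>) / K) powr n = norm (trig_poly d X b \<xi>) ^ n / K ^ n"
      using n \<open>K > 0\<close> by (simp add: powr_realpow' power_divide)
    finally have "K * (norm (trig_poly d X b \<xi>) / K * norm (h \<xi>))
        \<le> K * (norm (trig_poly d X b \<xi>) ^ n / K ^ n / n + norm (h \<xi>) powr q / q)"
      using \<open>K > 0\<close> by (intro mult_left_mono) auto
    then show "norm (trig_poly d X b \<xi> * h \<xi>)
        \<le> K / (K ^ n * n) * norm (trig_poly d X b \<xi>) ^ n + K / q * norm (h \<xi>) powr q"
      using \<open>K > 0\<close> by (simp add: norm_mult algebra_simps)
  qed (use int in auto)
  also have "\<dots> = K / (K ^ n * n) * (\<integral>\<xi>. norm (trig_poly d X b \<xi>) ^ n \<partial>torus d) + K / q * (\<integral>\<xi>. norm (h \<xi>) powr q \<partial>torus d)"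
    using int by simp
  also have "\<dots> \<le> K / (K ^ n * n) * K ^ n + K / q * 1"
    using assms by (intro add_mono mult_left_mono) auto
  also have "\<dots> = K * (1 / real n + 1 / q)" using \<open>K > 0\<close> by (simp add: field_simps)
  finally show ?thesis using assms by simp
qed

lemma trig_poly_pairing_2:
  assumes "finite X" "X \<subseteq> int_lattice d" "simple_function (torus d) h"
    "(\<Sum>x\<in>X. norm (b x) powr 2) = 1" "(\<integral>\<xi>. norm (h \<xi>) powr 2 \<partial>torus d) \<le> 1"
  shows "norm (\<integral>\<xi>. trig_poly d X b \<xi> * h \<xi> \<partial>torus d) \<le> 1"
  using assms integral_norm_trig_poly_2[of X d b]
  by (intro trig_poly_pairing_Hoelder[where n = 2 and q = 2]) auto

lemma trig_poly_pairing_4: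
  assumes "finite X" "X \<subseteq> int_lattice d" "simple_function (torus d) h"
    "(\<Sum>x\<in>X. norm (b x) powr (4/3)) = 1" "\<And>x. x \<in> X \<Longrightarrow> norm (b x) powr (4/3) \<le> T"
    "0 \<le> T" "T \<le> 1" "(\<integral>\<xi>. norm (h \<xi>) powr (4/3) \<partial>torus d) \<le> 1"
  shows "norm (\<integral>\<xi>. trig_poly d X b \<xi> * h \<xi> \<partial>torus d) \<le> (1 - (1 - T) / 4096) powr (1/4)"
proof (rule trig_poly_pairing_Hoelder[where n = 4 and q = "4/3"])
  have "((1 - (1 - T) / 4096) powr (1/4)) ^ 4 = 1 - (1 - T) / 4096"
    using assms by (subst powr_realpow'[symmetric]) (auto simp: powr_powr)
  then show "(\<integral>\<xi>. norm (trig_poly d X b \<xi>) ^ 4 \<partial>torus d) \<le> ((1 - (1 - T) / 4096) powr (1/4)) ^ 4"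
    using integral_norm_trig_poly_4_le[OF assms(1,2,4,5)] by simp
qed (use assms in auto)

text \<open>Weighted arithmetic-geometric mean of 1 - u and 1. It makes the interpolated gain linear
  in 1 - T, whence the exponent \<gamma> = 1.\<close>

lemma powr_le_linear:
  fixes u \<kappa> :: real
  assumes "0 \<le> \<kappa>" "\<kappa> \<le> 1" "u < 1"
  shows "(1 - u) powr \<kappa> \<le> 1 - \<kappa> * u"
  using Youngs_inequality_0[of \<kappa> "1 - \<kappa>" "1 - u" 1] assms by (simp add: algebra_simps)

text \<open>The factor 1/4096 comes from \<open>concentration\<close>; the numerator is one quarter,
  for the fourth root in \<open>trig_poly_pairing_4\<close>, of the interpolation weight of the edge
  4/3. The branches agree at 4/3 and vanish at 1 and 2.\<close>

definition gain :: "real \<Rightarrow> real" where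
  "gain p = (if p \<le> 4 / 3 then 1 - 1 / p else 1 / p - 1 / 2) / 4096"

lemma gain_pos: "1 < p \<Longrightarrow> p < 2 \<Longrightarrow> 0 < gain p" and gain_lt_1: "1 < p \<Longrightarrow> gain p < 1"
  by (auto simp: gain_def field_simps)

text \<open>The exponent 4/3 is joined to 1 below and to 2 above, where the bound 1 is used. On an
  edge, |b| raised to the edge exponent equals |a|^p, so the normalisation and the bound by
  \<open>T\<close>, both phrased with p-th powers, carry over.\<close>

lemma trig_poly_pairing:
  assumes p: "1 < p" "p < 2" and X: "finite X" "X \<subseteq> int_lattice d" and g: "simple_function (torus d) g"
    and a: "(\<Sum>x\<in>X. norm (a x) powr p) = 1" "\<And>x. x \<in> X \<Longrightarrow> norm (a x) powr p \<le> T"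
    and T: "0 \<le> T" "T \<le> 1" and g1: "(\<integral>\<xi>. norm (g \<xi>) powr p \<partial>torus d) \<le> 1"
  shows "norm (\<integral>\<xi>. trig_poly d X a \<xi> * g \<xi> \<partial>torus d) \<le> 1 - gain p * (1 - T)"
proof -
  define u where "u = (1 - T) / 4096"
  have u: "0 \<le> u" "u < 1" using T by (auto simp: u_def)
  have "\<exists>\<kappa>. 0 \<le> \<kappa> \<and> \<kappa> \<le> 1 \<and> gain p = \<kappa> / 4096 \<and>
    norm (\<integral>\<xi>. trig_poly d X a \<xi> * g \<xi> \<partial>torus d) \<le> (1 - u) powr \<kappa>"
  proof (cases "p \<le> 4 / 3")
    case True
    \<comment> \<open>Solves 1/p = (1 - \<theta>) + 3\<theta>/4; the edge 4/3 has weight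
      \<theta>.\<close>
    define \<theta> where "\<theta> = 4 * (1 - 1 / p)"
    have \<theta>: "0 \<le> \<theta>" "\<theta> \<le> 1" using p True by (auto simp: \<theta>_def field_simps)
    have "norm (\<integral>\<xi>. trig_poly d X a \<xi> * g \<xi> \<partial>torus d) \<le> 1 powr (1 - \<theta>) * ((1 - u) powr (1/4)) powr \<theta>"
    proof (rule trig_poly_interpolation[where ?p0.0 = 1 and ?p1.0 = "4/3", OF X(1) g _ _ \<theta>])
      show "1 / p = (1 - \<theta>) / 1 + \<theta> / (4/3)" using p by (simp add: \<theta>_def field_simps)
    next
      fix b :: "(nat \<Rightarrow> int) \<Rightarrow> complex" and h :: "(nat \<Rightarrow> real) \<Rightarrow> complex"
      assume h: "simple_function (torus d) h" "\<And>x. norm (b x) powr 1 = norm (a x) powr p"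
        "\<And>\<xi>. norm (h \<xi>) powr 1 = norm (g \<xi>) powr p"
      show "norm (\<integral>\<xi>. trig_poly d X b \<xi> * h \<xi> \<partial>torus d) \<le> 1"
        using h(2,3) a g1 by (intro trig_poly_pairing_1 h(1)) auto
    next
      fix b :: "(nat \<Rightarrow> int) \<Rightarrow> complex" and h :: "(nat \<Rightarrow> real) \<Rightarrow> complex"
      assume h: "simple_function (torus d) h" "\<And>x. norm (b x) powr (4/3) = norm (a x) powr p"
        "\<And>\<xi>. norm (h \<xi>) powr (4/3) = norm (g \<xi>) powr p"
      show "norm (\<integral>\<xi>. trig_poly d X b \<xi> * h \<xi> \<partial>torus d) \<le> (1 - u) powr (1/4)"
        unfolding u_def using a g1 T by (intro trig_poly_pairing_4 h(1) X) (simp_all only: h(2,3))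
    qed (use p u in auto)
    then show ?thesis
      using p True u \<theta> by (intro exI[of _ "\<theta> / 4"]) (simp_all add: powr_powr gain_def, simp add: \<theta>_def)
  next
    case False
    \<comment> \<open>Solves 1/p = 3(1 - \<theta>)/4 + \<theta>/2; now the edge 4/3 has weight 1 -
      \<theta>.\<close>
    define \<theta> where "\<theta> = 3 - 4 / p"
    have \<theta>: "0 \<le> \<theta>" "\<theta> \<le> 1" using p False by (auto simp: \<theta>_def field_simps)
    have "norm (\<integral>\<xi>. trig_poly d X a \<xi> * g \<xi> \<partial>torus d) \<le> ((1 - u) powr (1/4)) powr (1 - \<theta>) * 1 powr \<theta>"
    proof (rule trig_poly_interpolation[where ?p0.0 = "4/3" and ?p1.0 = 2, OF X(1) g _ _ \<theta>])
      show "1 / p = (1 - \<theta>) / (4/3) + \<theta> / 2" using p by (simp add: \<theta>_def field_simps)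
    next
      fix b :: "(nat \<Rightarrow> int) \<Rightarrow> complex" and h :: "(nat \<Rightarrow> real) \<Rightarrow> complex"
      assume h: "simple_function (torus d) h" "\<And>x. norm (b x) powr 2 = norm (a x) powr p"
        "\<And>\<xi>. norm (h \<xi>) powr 2 = norm (g \<xi>) powr p"
      show "norm (\<integral>\<xi>. trig_poly d X b \<xi> * h \<xi> \<partial>torus d) \<le> 1"
        using a g1 by (intro trig_poly_pairing_2 h(1) X) (simp_all only: h(2,3))
    next
      fix b :: "(nat \<Rightarrow> int) \<Rightarrow> complex" and h :: "(nat \<Rightarrow> real) \<Rightarrow> complex"
      assume h: "simple_function (torus d) h" "\<And>x. norm (b x) powr (4/3) = norm (a x) powr p"
        "\<And>\<xi>. norm (h \<xi>) powr (4/3) = norm (g \<xi>) powr p"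
      show "norm (\<integral>\<xi>. trig_poly d X b \<xi> * h \<xi> \<partial>torus d) \<le> (1 - u) powr (1/4)"
        unfolding u_def using a g1 T by (intro trig_poly_pairing_4 h(1) X) (simp_all only: h(2,3))
    qed (use p u in auto)
    then show ?thesis
      using p False u \<theta> by (intro exI[of _ "(1 - \<theta>) / 4"]) (simp_all add: powr_powr gain_def, simp add: \<theta>_def)
  qed
  then show ?thesis
    using powr_le_linear[OF _ _ u(2)] u by (force simp: u_def)
qed

section \<open>Duality\<close>

lemma powr_conjugate_le:
  fixes I K p :: real
  assumes "p > 1" "I \<ge> 0" "K \<ge> 0" "I \<le> K * I powr (1 / p)"
  shows "I \<le> K powr (p / (p - 1))"
proof (cases "I = 0")
  case False
  then have I: "I > 0" using assms by simp
  have "I powr (1 - 1 / p) = I / I powr (1 / p)"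
    using I by (simp add: powr_diff)
  also have "\<dots> \<le> K"
    using assms(4) I by (simp add: divide_le_eq)
  finally have "(I powr (1 - 1 / p)) powr (p / (p - 1)) \<le> K powr (p / (p - 1))"
    using assms by (intro powr_mono2) auto
  moreover have "(1 - 1 / p) * (p / (p - 1)) = 1" using assms by (simp add: field_simps)
  ultimately show ?thesis unfolding powr_powr using I by (metis powr_one less_imp_le)
qed simp

text \<open>The converse of Hoelder's inequality. The extremal test function need not be simple, so
  simple functions approximate it under dominated convergence.\<close>

lemma conjugate_norm_le:
  fixes h :: "'a \<Rightarrow> complex"
  assumes "prob_space M" and h [measurable]: "h \<in> borel_measurable M"
    and B: "\<And>\<xi>. norm (h \<xi>) \<le> B" and p: "p > 1" and K: "K \<ge> 0"
    and dual: "\<And>g. simple_function M g \<Longrightarrow> (\<integral>\<xi>. norm (g \<xi>) powr p \<partial>M) \<le> 1 \<Longrightarrow>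
        norm (\<integral>\<xi>. h \<xi> * g \<xi> \<partial>M) \<le> K"
  shows "(\<integral>\<xi>. norm (h \<xi>) powr (p / (p - 1)) \<partial>M) \<le> K powr (p / (p - 1))"
proof -
  interpret prob_space M by fact
  define q where "q = p / (p - 1)"
  have q: "q > 1" "(q - 1) * p = q" using p by (auto simp: q_def field_simps)
  \<comment> \<open>The extremal choice, with |g|^p = |h|^q and h g = |h|^q.\<close>
  define g where "g = (\<lambda>\<xi>. cnj (h \<xi>) * of_real (norm (h \<xi>) powr (q - 2)))"
  define I where "I = (\<integral>\<xi>. norm (h \<xi>) powr q \<partial>M)"
  have [measurable]: "g \<in> borel_measurable M"
  proof -
    have [measurable]: "cnj \<in> borel_measurable borel" "complex_of_real \<in> borel_measurable borel"
      by (intro borel_measurable_continuous_onI continuous_intros)+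
    show ?thesis unfolding g_def by measurable
  qed
  have norm_g: "norm (g \<xi>) = norm (h \<xi>) powr (q - 1)" for \<xi>
    by (simp add: g_def norm_mult powr_mult_base)
  have h_g: "h \<xi> * g \<xi> = of_real (norm (h \<xi>) powr q)" for \<xi>
  proof -
    have "h \<xi> * g \<xi> = of_real ((norm (h \<xi>))\<^sup>2) * of_real (norm (h \<xi>) powr (q - 2))"
      unfolding complex_norm_square by (simp add: g_def)
    also have "\<dots> = of_real (norm (h \<xi>) powr q)"
      by (simp add: power2_eq_square powr_mult_base mult.assoc flip: of_real_mult)
    finally show ?thesis .
  qed
  have B0: "B \<ge> 0" using order_trans[OF norm_ge_zero B] .
  have gB: "norm (g \<xi>) \<le> B powr (q - 1)" for \<xi>
    unfolding norm_g using q B by (intro powr_mono2) auto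
  have I0: "I \<ge> 0" by (simp add: I_def)
  obtain s where "\<forall>i. simple_function M (s i)" "\<forall>\<xi>\<in>space M. (\<lambda>i. s i \<xi>) \<longlonglongrightarrow> g \<xi>"
    "\<forall>i. \<forall>\<xi>\<in>space M. dist (s i \<xi>) 0 \<le> 2 * dist (g \<xi>) 0"
    using borel_measurable_implies_sequence_metric[of g M 0] by auto
  then have s: "\<And>i. simple_function M (s i)" "\<And>\<xi>. \<xi> \<in> space M \<Longrightarrow> (\<lambda>i. s i \<xi>) \<longlonglongrightarrow> g \<xi>"
    "\<And>i \<xi>. \<xi> \<in> space M \<Longrightarrow> norm (s i \<xi>) \<le> 2 * norm (g \<xi>)"
    by auto
  have sB: "norm (s i \<xi>) \<le> 2 * B powr (q - 1)" if "\<xi> \<in> space M" for i \<xi>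
    using s(3)[OF that, of i] gB[of \<xi>] by simp
  have [measurable]: "s i \<in> borel_measurable M" for i
    using s(1) by (rule borel_measurable_simple_function)
  have lim_norm: "(\<lambda>i. \<integral>\<xi>. norm (s i \<xi>) powr p \<partial>M) \<longlonglongrightarrow> I"
  proof -
    have "(\<lambda>i. \<integral>\<xi>. norm (s i \<xi>) powr p \<partial>M) \<longlonglongrightarrow> (\<integral>\<xi>. norm (g \<xi>) powr p \<partial>M)"
    proof (rule integral_dominated_convergence[where w = "\<lambda>_. (2 * B powr (q - 1)) powr p"])
      show "AE \<xi> in M. (\<lambda>i. norm (s i \<xi>) powr p) \<longlonglongrightarrow> norm (g \<xi>) powr p"
        using s(2) p by (auto intro!: AE_I2 tendsto_powr' tendsto_norm tendsto_const)
      show "AE \<xi> in M. norm (norm (s i \<xi>) powr p) \<le> (2 * B powr (q - 1)) powr p" for i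
        using sB p by (auto intro!: AE_I2 powr_mono2)
    qed auto
    then show ?thesis by (simp add: norm_g powr_powr q I_def)
  qed
  have lim_pair: "(\<lambda>i. \<integral>\<xi>. h \<xi> * s i \<xi> \<partial>M) \<longlonglongrightarrow> of_real I"
  proof -
    have "(\<lambda>i. \<integral>\<xi>. h \<xi> * s i \<xi> \<partial>M) \<longlonglongrightarrow> (\<integral>\<xi>. h \<xi> * g \<xi> \<partial>M)"
    proof (rule integral_dominated_convergence[where w = "\<lambda>_. B * (2 * B powr (q - 1))"])
      show "AE \<xi> in M. (\<lambda>i. h \<xi> * s i \<xi>) \<longlonglongrightarrow> h \<xi> * g \<xi>"
        using s(2) by (auto intro!: AE_I2 tendsto_mult_left)
      show "AE \<xi> in M. norm (h \<xi> * s i \<xi>) \<le> B * (2 * B powr (q - 1))" for i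
        unfolding norm_mult using sB B B0 by (intro AE_I2 mult_mono) auto
    qed auto
    then show ?thesis by (simp add: h_g I_def)
  qed
  \<comment> \<open>Dividing by \<open>t\<close> makes the approximants eventually admissible in
    \<open>dual\<close>, since their p-th moments tend to I < t^p. The strict bound also keeps
    \<open>t\<close> positive when I = 0.\<close>
  have le: "I \<le> K * t" if t: "t > I powr (1 / p)" for t
  proof -
    have t0: "t > 0" using t by (metis le_less_trans powr_ge_zero)
    have "(I powr (1 / p)) powr p < t powr p"
      using t p by (intro powr_less_mono2) auto
    then have "I < t powr p" using p I0 by (simp add: powr_powr)
    from order_tendstoD(2)[OF lim_norm this]
    have "\<forall>\<^sub>F i in sequentially. norm (\<integral>\<xi>. h \<xi> * s i \<xi> \<partial>M) \<le> K * t"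
    proof eventually_elim
      case (elim i)
      have "(\<integral>\<xi>. norm (s i \<xi> / of_real t) powr p \<partial>M) = (\<integral>\<xi>. norm (s i \<xi>) powr p \<partial>M) / t powr p"
        using t0 by (simp add: norm_divide powr_divide)
      also have "\<dots> \<le> 1" using elim t0 by (simp add: divide_le_eq)
      finally have "norm (\<integral>\<xi>. h \<xi> * (s i \<xi> / of_real t) \<partial>M) \<le> K"
        using simple_function_compose[OF s(1)[of i], of "\<lambda>w. w / of_real t"]
        by (intro dual) (auto simp: comp_def)
      then have "norm (\<integral>\<xi>. h \<xi> * s i \<xi> \<partial>M) / t \<le> K" using t0 by (simp add: norm_divide)
      then show ?case using t0 by (simp add: divide_le_eq)
    qed
    from tendsto_upperbound[OF tendsto_norm[OF lim_pair] this] show ?thesis using I0 by simp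
  qed
  have "I \<le> K * I powr (1 / p)"
  proof (rule tendsto_lowerbound)
    show "((\<lambda> t. K * t) \<longlongrightarrow> K * I powr (1 / p)) (at_right (I powr (1 / p)))"
      by (intro tendsto_intros)
    show "\<forall>\<^sub>F t in at_right (I powr (1 / p)). I \<le> K * t"
      using le by (auto intro: eventually_at_rightI[of _ "I powr (1 / p) + 1"])
  qed simp
  then show ?thesis
    using powr_conjugate_le[OF p I0 K] unfolding I_def q_def by blast
qed

text \<open>Rescale \<open>trig_poly_pairing\<close> by \<open>N\<close> and dualise. The bound is
  increasing in \<open>N\<close> and in \<open>S\<close>, which later allows the passage from finite
  sets to the lattice.\<close>

lemma Hausdorff_Young_trig_poly:
  assumes p: "1 < p" "p < 2" and X: "finite X" "X \<subseteq> int_lattice d"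
    and N: "(\<Sum>x\<in>X. norm (a x) powr p) = N powr p" "N \<ge> 0"
    and S: "\<And>x. x \<in> X \<Longrightarrow> norm (a x) \<le> S" "S \<ge> 0"
  shows "(\<integral>\<xi>. norm (trig_poly d X a \<xi>) powr (p / (p - 1)) \<partial>torus d)
     \<le> ((1 - gain p) * N + gain p * S) powr (p / (p - 1))"
proof (cases "N = 0")
  case True
  then have "\<forall>x\<in>X. norm (a x) powr p = 0"
    using N X(1) by (subst sum_nonneg_eq_0_iff[symmetric]) auto
  then have "trig_poly d X a \<xi> = 0" for \<xi> by (simp add: trig_poly_def)
  then show ?thesis by simp
next
  case False
  then have N0: "N > 0" using N by simp
  \<comment> \<open>\<open>S\<close> is any upper bound of the moduli and may exceed
    \<open>N\<close>; the cap keeps \<open>T\<close> in the range that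
    \<open>trig_poly_pairing\<close> demands, with N T at most S.\<close>
  define T where "T = min 1 (S / N)"
  have T: "0 \<le> T" "T \<le> 1" "N * T \<le> S" using N0 S by (auto simp: T_def min_def field_simps)
  have le_N: "norm (a x) \<le> N" if "x \<in> X" for x
  proof -
    have le: "norm (a x) powr p \<le> N powr p"
      unfolding N(1)[symmetric] using X that by (intro member_le_sum[of _ _ "\<lambda>x. norm (a x) powr p"]) auto
    have "(norm (a x) powr p) powr (1 / p) \<le> (N powr p) powr (1 / p)"
      by (rule powr_mono2) (use p le in auto)
    then show ?thesis unfolding powr_powr using N0 p by simp
  qed
  define b where "b = (\<lambda>x. a x / of_real N)"
  have b_le: "norm (b x) powr p \<le> T" if "x \<in> X" for x
  proof -
    have "norm (b x) \<le> T" using le_N[OF that] S(1)[OF that] N0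
      by (simp add: b_def T_def norm_divide divide_le_eq divide_right_mono)
    \<comment> \<open>Numbers in [0,1] do not grow under a power p > 1, so a bound on |b| also
      bounds its p-th power.\<close>
    moreover have "norm (b x) powr p \<le> norm (b x) powr 1"
      using calculation T p by (intro powr_mono') auto
    ultimately show ?thesis by simp
  qed
  have b1: "(\<Sum>x\<in>X. norm (b x) powr p) = 1"
    using N0 N by (simp add: b_def norm_divide powr_divide flip: sum_divide_distrib)
  have "(\<integral>\<xi>. norm (trig_poly d X b \<xi>) powr (p / (p - 1)) \<partial>torus d) \<le> (1 - gain p * (1 - T)) powr (p / (p - 1))"
  proof (rule conjugate_norm_le[OF prob_space_torus trig_poly_measurable norm_trig_poly_le p(1)])
    have "gain p * (1 - T) \<le> 1 * 1" using gain_lt_1[OF p(1)] gain_pos[OF p] T by (intro mult_mono) auto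
    then show "0 \<le> 1 - gain p * (1 - T)" by simp
  qed (rule trig_poly_pairing[OF p X _ b1 b_le T(1,2)])
  then have "N powr (p / (p - 1)) * (\<integral>\<xi>. norm (trig_poly d X b \<xi>) powr (p / (p - 1)) \<partial>torus d)
      \<le> N powr (p / (p - 1)) * (1 - gain p * (1 - T)) powr (p / (p - 1))"
    by (intro mult_left_mono) auto
  also have "\<dots> = (N * (1 - gain p * (1 - T))) powr (p / (p - 1))"
    by (simp add: powr_mult)
  also have "\<dots> \<le> ((1 - gain p) * N + gain p * S) powr (p / (p - 1))"
  proof (intro powr_mono2)
    have "gain p * (1 - T) \<le> 1 * 1" using gain_lt_1[OF p(1)] gain_pos[OF p] T by (intro mult_mono) auto
    then show "0 \<le> N * (1 - gain p * (1 - T))" using N0 by simp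
    have "gain p * (N * T) \<le> gain p * S" using gain_pos[OF p] T by simp
    then show "N * (1 - gain p * (1 - T)) \<le> (1 - gain p) * N + gain p * S" by (simp add: algebra_simps)
  qed (use p in auto)
  also have "N powr (p / (p - 1)) * (\<integral>\<xi>. norm (trig_poly d X b \<xi>) powr (p / (p - 1)) \<partial>torus d)
     = (\<integral>\<xi>. norm (trig_poly d X a \<xi>) powr (p / (p - 1)) \<partial>torus d)"
  proof -
    have "trig_poly d X a \<xi> = of_real N * trig_poly d X b \<xi>" for \<xi>
      using N0 by (simp add: trig_poly_def b_def sum_distrib_left)
    then have "norm (trig_poly d X a \<xi>) powr (p / (p - 1)) = N powr (p / (p - 1)) * norm (trig_poly d X b \<xi>) powr (p / (p - 1))" for \<xi>
      using N0 by (simp add: norm_mult powr_mult)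
    then show ?thesis by simp
  qed
  finally show ?thesis .
qed

section \<open>Fourier transforms of infinitely supported functions\<close>

lemma nn_integral_trig_poly:
  assumes "q > 0"
  shows "(\<integral>\<^sup>+\<xi>. ennreal (norm (trig_poly d X a \<xi>) powr q) \<partial>torus d)
    = ennreal (\<integral>\<xi>. norm (trig_poly d X a \<xi>) powr q \<partial>torus d)"
proof (rule nn_integral_eq_integral)
  show "integrable (torus d) (\<lambda>\<xi>. norm (trig_poly d X a \<xi>) powr q)"
    using assms by (intro integrable_bounded_torus[where B = "(\<Sum>x\<in>X. norm (a x)) powr q"])
      (auto intro!: powr_mono2 norm_trig_poly_le)
qed simp

lemma Lq_norm_le_iff:
  assumes "q > 0" "C \<ge> 0"
  shows "Lq_norm M q g \<le> ennreal C \<longleftrightarrow> (\<integral>\<^sup>+ y. ennreal (cmod (g y) powr q) \<partial>M) \<le> ennreal (C powr q)"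
proof -
  define I where "I = (\<integral>\<^sup>+ y. ennreal (cmod (g y) powr q) \<partial>M)"
  show ?thesis
  proof (cases I)
    case (real r)
    have "r powr (1 / q) \<le> C \<longleftrightarrow> r \<le> C powr q"
    proof
      assume "r powr (1 / q) \<le> C"
      then have "(r powr (1 / q)) powr q \<le> C powr q" using assms by (intro powr_mono2) auto
      then show "r \<le> C powr q" using assms real by (simp add: powr_powr)
    next
      assume "r \<le> C powr q"
      then have "r powr (1 / q) \<le> (C powr q) powr (1 / q)" using assms real by (intro powr_mono2) auto
      then show "r powr (1 / q) \<le> C" using assms by (simp add: powr_powr)
    qed
    then show ?thesis
      using real assms unfolding Lq_norm_def I_def[symmetric] by (simp add: Let_def)
  next
    case top
    then show ?thesis unfolding Lq_norm_def I_def[symmetric] by (simp add: top_unique)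
  qed
qed

text \<open>Convergence in L^2 gives convergence almost everywhere along a sequence of partial sums,
  and Fatou's lemma carries the uniform bound to the limit. Any representative \<open>g\<close>
  qualifies.\<close>

lemma is_fourier_transform_bound:
  assumes g: "is_fourier_transform d f g" and q: "q > 0" and "C \<ge> 0"
    and bound: "\<And>F. finite F \<Longrightarrow> F \<subseteq> int_lattice d \<Longrightarrow>
      (\<integral>\<xi>. norm (trig_poly d F f \<xi>) powr q \<partial>torus d) \<le> C powr q"
  shows "Lq_norm (torus d) q g \<le> ennreal C"
proof -
  have [measurable]: "g \<in> borel_measurable (torus d)"
    using g by (simp add: is_fourier_transform_def)
  have "\<exists>F. finite F \<and> F \<subseteq> int_lattice d \<and>
      Lq_norm (torus d) 2 (\<lambda>\<xi>. g \<xi> - trig_poly d F f \<xi>) \<le> ennreal (1 / real (Suc n))" for n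
  proof -
    have lim: "((\<lambda>F. Lq_norm (torus d) 2 (\<lambda>\<xi>. g \<xi> - trig_poly d F f \<xi>)) \<longlongrightarrow> 0)
        (finite_subsets_at_top (int_lattice d))"
      using g unfolding is_fourier_transform_def trig_poly_def[symmetric] by simp
    have "\<forall>\<^sub>F F in finite_subsets_at_top (int_lattice d).
        Lq_norm (torus d) 2 (\<lambda>\<xi>. g \<xi> - trig_poly d F f \<xi>) < ennreal (1 / real (Suc n))"
      by (rule order_tendstoD(2)[OF lim]) simp
    then show ?thesis
      unfolding eventually_finite_subsets_at_top by (meson less_imp_le order_refl)
  qed
  then obtain F where F: "\<And>n. finite (F n)" "\<And>n. F n \<subseteq> int_lattice d"
      "\<And>n. Lq_norm (torus d) 2 (\<lambda>\<xi>. g \<xi> - trig_poly d (F n) f \<xi>) \<le> ennreal (1 / real (Suc n))"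
    by metis
  define u where "u = (\<lambda>n \<xi>. norm (g \<xi> - trig_poly d (F n) f \<xi>) powr 2)"
  have [measurable]: "u n \<in> borel_measurable (torus d)" for n
    unfolding u_def by measurable
  have u: "(\<integral>\<^sup>+\<xi>. ennreal (u n \<xi>) \<partial>torus d) \<le> ennreal ((1 / real (Suc n)) powr 2)" for n
    using F(3)[of n] unfolding u_def by (subst (asm) Lq_norm_le_iff) auto
  have int: "integrable (torus d) (u n)" for n
    using u[of n] by (intro integrableI_nonneg) (auto simp: u_def intro!: AE_I2 elim: order_le_less_trans)
  have "(\<integral>\<xi>. u n \<xi> \<partial>torus d) \<le> (1 / real (Suc n)) powr 2" for n
    using u[of n] int by (subst (asm) nn_integral_eq_integral) (auto simp: u_def)
  then have "\<bar>\<integral>\<xi>. u n \<xi> \<partial>torus d\<bar> \<le> (1 / real (Suc n)) * 1" for n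
  proof -
    have "(\<integral>\<xi>. u n \<xi> \<partial>torus d) \<le> (1 / real (Suc n)) * (1 / real (Suc n))"
      using \<open>(\<integral>\<xi>. u n \<xi> \<partial>torus d) \<le> (1 / real (Suc n)) powr 2\<close> by (simp add: power2_eq_square)
    also have "\<dots> \<le> (1 / real (Suc n)) * 1" by (intro mult_left_mono) auto
    finally show ?thesis by (simp add: u_def)
  qed
  then have "(\<lambda>n. \<integral>\<xi>. norm (u n \<xi>) \<partial>torus d) \<longlonglongrightarrow> 0"
    by (intro Lim_null_comparison[OF _ LIMSEQ_inverse_real_of_nat]) (auto simp: u_def inverse_eq_divide)
  from tendsto_L1_AE_subseq[OF int this] obtain r
    where r: "AE \<xi> in torus d. (\<lambda>n. u (r n) \<xi>) \<longlonglongrightarrow> 0" by blast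
  have "AE \<xi> in torus d. ennreal (norm (g \<xi>) powr q)
      = liminf (\<lambda>n. ennreal (norm (trig_poly d (F (r n)) f \<xi>) powr q))"
    using r
  proof eventually_elim
    case (elim \<xi>)
    then have "(\<lambda>n. sqrt (u (r n) \<xi>)) \<longlonglongrightarrow> 0"
      using tendsto_real_sqrt by fastforce
    then have "(\<lambda>n. norm (trig_poly d (F (r n)) f \<xi> - g \<xi>)) \<longlonglongrightarrow> 0"
      by (simp add: u_def norm_minus_commute)
    then have "(\<lambda>n. trig_poly d (F (r n)) f \<xi>) \<longlonglongrightarrow> g \<xi>"
      by (simp add: tendsto_norm_zero_iff LIM_zero_iff)
    then have "(\<lambda>n. ennreal (norm (trig_poly d (F (r n)) f \<xi>) powr q)) \<longlonglongrightarrow> ennreal (norm (g \<xi>) powr q)"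
      using q by (intro tendsto_ennrealI tendsto_powr' tendsto_norm tendsto_const) auto
    then show ?case by (rule lim_imp_Liminf[OF trivial_limit_sequentially, symmetric])
  qed
  then have "(\<integral>\<^sup>+\<xi>. ennreal (norm (g \<xi>) powr q) \<partial>torus d)
     = (\<integral>\<^sup>+\<xi>. liminf (\<lambda>n. ennreal (norm (trig_poly d (F (r n)) f \<xi>) powr q)) \<partial>torus d)"
    by (rule nn_integral_cong_AE)
  also have "\<dots> \<le> liminf (\<lambda>n. \<integral>\<^sup>+\<xi>. ennreal (norm (trig_poly d (F (r n)) f \<xi>) powr q) \<partial>torus d)"
    by (rule nn_integral_liminf) simp
  also have "\<dots> \<le> limsup (\<lambda>n. \<integral>\<^sup>+\<xi>. ennreal (norm (trig_poly d (F (r n)) f \<xi>) powr q) \<partial>torus d)"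
    by (rule Liminf_le_Limsup) simp
  also have "\<dots> \<le> ennreal (C powr q)"
    using bound F q by (intro Limsup_bounded always_eventually allI) (simp add: nn_integral_trig_poly ennreal_leI)
  finally show ?thesis using q \<open>C \<ge> 0\<close> by (simp add: Lq_norm_le_iff)
qed

lemma summable_on_small_tail:
  fixes \<phi> :: "'a \<Rightarrow> real"
  assumes "\<phi> summable_on E" "\<And>x. \<phi> x \<ge> 0" "e > 0"
  obtains F where "finite F" "F \<subseteq> E" "\<And>G. finite G \<Longrightarrow> G \<subseteq> E - F \<Longrightarrow> sum \<phi> G \<le> e"
proof -
  have "(sum \<phi> \<longlongrightarrow> infsum \<phi> E) (finite_subsets_at_top E)"
    using has_sum_infsum[OF assms(1)] by (simp add: has_sum_def)
  then have "\<forall>\<^sub>F F in finite_subsets_at_top E. infsum \<phi> E - e < sum \<phi> F"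
    using assms(3) by (intro order_tendstoD) auto
  then obtain F where F: "finite F" "F \<subseteq> E" "infsum \<phi> E - e < sum \<phi> F"
    unfolding eventually_finite_subsets_at_top by blast
  have "sum \<phi> G \<le> e" if "finite G" "G \<subseteq> E - F" for G
  proof -
    have "sum \<phi> (F \<union> G) \<le> infsum \<phi> E"
      using F that assms by (intro finite_sum_le_infsum) auto
    moreover have "sum \<phi> (F \<union> G) = sum \<phi> F + sum \<phi> G"
      using F that by (intro sum.union_disjoint) auto
    ultimately show ?thesis using F(3) by simp
  qed
  with F that show thesis by blast
qed

text \<open>The difference is again a trigonometric polynomial, with coefficients \<open>f\<close>
  up to sign, so Plancherel measures its size.\<close>

lemma trig_poly_diff:
  assumes "finite X" "finite Y"
  shows "trig_poly d X f \<xi> - trig_poly d Y f \<xi>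
    = trig_poly d ((X - Y) \<union> (Y - X)) (\<lambda>x. if x \<in> X then f x else - f x) \<xi>"
proof -
  let ?t = "\<lambda>x. fourier_mode d x \<xi> * f x"
  have "sum ?t X = sum ?t (X - Y) + sum ?t (X \<inter> Y)" "sum ?t Y = sum ?t (Y - X) + sum ?t (X \<inter> Y)"
    using assms by (simp_all add: sum.Int_Diff[of X ?t Y] sum.Int_Diff[of Y ?t X] Int_commute)
  moreover have "trig_poly d ((X - Y) \<union> (Y - X)) (\<lambda>x. if x \<in> X then f x else - f x) \<xi>
      = sum ?t (X - Y) + (- sum ?t (Y - X))"
    unfolding trig_poly_def using assms
    by (subst sum.union_disjoint) (auto simp: sum_negf[symmetric] intro!: sum.cong)
  ultimately show ?thesis by (simp add: trig_poly_def)
qed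

lemma integral_trig_poly_diff:
  assumes "finite X" "finite Y" "X \<subseteq> int_lattice d" "Y \<subseteq> int_lattice d"
  shows "(\<integral>\<^sup>+\<xi>. ennreal ((norm (trig_poly d X f \<xi> - trig_poly d Y f \<xi>))\<^sup>2) \<partial>torus d)
     = ennreal (\<Sum>x\<in>(X - Y) \<union> (Y - X). (norm (f x))\<^sup>2)"
proof -
  have "(\<integral>\<^sup>+\<xi>. ennreal ((norm (trig_poly d X f \<xi> - trig_poly d Y f \<xi>))\<^sup>2) \<partial>torus d)
     = ennreal (\<Sum>x\<in>(X - Y) \<union> (Y - X). (norm (if x \<in> X then f x else - f x))\<^sup>2)"
    unfolding trig_poly_diff[OF assms(1,2)]
    using assms nn_integral_trig_poly[of 2 d "(X - Y) \<union> (Y - X)"]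
    by (subst integral_norm_trig_poly_2[symmetric]) auto
  then show ?thesis by (simp add: if_distrib cong: if_cong)
qed

text \<open>The Riesz-Fischer theorem, which gives the choice in \<open>fourier_transform\<close> a
  witness. The limit is built almost everywhere from a rapidly convergent sequence of partial sums;
  Fatou's lemma then controls its distance to every partial sum over a large finite set, as
  unconditional convergence requires.\<close>

lemma exists_fourier_transform:
  assumes f: "(\<lambda>x. (norm (f x))\<^sup>2) summable_on int_lattice d"
  shows "\<exists>g. is_fourier_transform d f g"
proof -
  \<comment> \<open>The rate 8^-n serves twice: 2^n 8^-n \<le> 2^-n makes the L^1 increments
    summable, and 8^-n \<le> (2^-n)^2 bounds the L^2 distances.\<close>
  have "\<exists>F. finite F \<and> F \<subseteq> int_lattice d \<and>
     (\<forall>G. finite G \<longrightarrow> G \<subseteq> int_lattice d - F \<longrightarrow> (\<Sum>x\<in>G. (norm (f x))\<^sup>2) \<le> (1/8) ^ n)" for n :: nat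
    by (rule summable_on_small_tail[OF f, of "(1/8)^n"]) auto
  then obtain F where F: "\<And>n. finite (F n)" "\<And>n. F n \<subseteq> int_lattice d"
     "\<And>n G. finite G \<Longrightarrow> G \<subseteq> int_lattice d - F n \<Longrightarrow> (\<Sum>x\<in>G. (norm (f x))\<^sup>2) \<le> (1/8) ^ n"
    by metis
  define H where "H = (\<lambda>n. \<Union>k\<le>n. F k)"
  have H: "finite (H n)" "H n \<subseteq> int_lattice d" "F n \<subseteq> H n" for n
    using F by (auto simp: H_def)
  have H_mono: "H n \<subseteq> H m" if "n \<le> m" for n m
    using that by (auto simp: H_def intro: order_trans)
  define s where "s = (\<lambda>n. trig_poly d (H n) f)"
  have [measurable]: "s n \<in> borel_measurable (torus d)" for n
    unfolding s_def by simp
  have L2: "(\<integral>\<^sup>+\<xi>. ennreal ((norm (trig_poly d X f \<xi> - trig_poly d Y f \<xi>))\<^sup>2) \<partial>torus d) \<le> ennreal ((1/8) ^ n)"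
    if "finite X" "finite Y" "X \<subseteq> int_lattice d" "Y \<subseteq> int_lattice d" "H n \<subseteq> X" "H n \<subseteq> Y" for X Y n
    unfolding integral_trig_poly_diff[OF that(1-4)]
    using that H(3)[of n] by (intro ennreal_leI F(3)) auto
  have L1: "(\<integral>\<^sup>+\<xi>. ennreal (norm (s (Suc n) \<xi> - s n \<xi>)) \<partial>torus d) \<le> ennreal ((1/2) ^ n)" for n
  proof -
    have "(\<integral>\<^sup>+\<xi>. ennreal (norm (s (Suc n) \<xi> - s n \<xi>)) \<partial>torus d)
       \<le> (\<integral>\<^sup>+\<xi>. ennreal (2 ^ n / 2) * ennreal ((norm (s (Suc n) \<xi> - s n \<xi>))\<^sup>2) + ennreal ((1/2) ^ n / 2) \<partial>torus d)"
    proof (intro nn_integral_mono)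
      fix \<xi>
      \<comment> \<open>Arithmetic-geometric mean, balanced against the rate 8^-n; on a space of
        mass 1 it passes from L^2 to L^1.\<close>
      have "t \<le> 2 ^ n / 2 * t\<^sup>2 + (1/2) ^ n / 2" for t :: real
      proof -
        have "2 * t * 2 ^ n \<le> (2 ^ n * t)\<^sup>2 + 1"
          using sum_squares_bound[of "2 ^ n * t" 1] by (simp add: mult_ac)
        then show ?thesis by (simp add: power2_eq_square power_divide field_simps)
      qed
      then show "ennreal (norm (s (Suc n) \<xi> - s n \<xi>))
          \<le> ennreal (2 ^ n / 2) * ennreal ((norm (s (Suc n) \<xi> - s n \<xi>))\<^sup>2) + ennreal ((1/2) ^ n / 2)"
        by (simp add: ennreal_mult[symmetric] ennreal_plus[symmetric] ennreal_leI del: ennreal_plus)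
    qed
    also have "\<dots> = ennreal (2 ^ n / 2) * (\<integral>\<^sup>+\<xi>. ennreal ((norm (s (Suc n) \<xi> - s n \<xi>))\<^sup>2) \<partial>torus d)
        + ennreal ((1/2) ^ n / 2)"
      using prob_space.emeasure_space_1[OF prob_space_torus]
      by (subst nn_integral_add) (auto simp: nn_integral_cmult)
    also have "\<dots> \<le> ennreal (2 ^ n / 2) * ennreal ((1/8) ^ n) + ennreal ((1/2) ^ n / 2)"
      unfolding s_def using H H_mono[of n "Suc n"] by (intro add_right_mono mult_left_mono L2) auto
    also have "\<dots> = ennreal (2 ^ n / 2 * (1/8) ^ n + (1/2) ^ n / 2)"
      by (simp add: ennreal_mult[symmetric] ennreal_plus[symmetric] del: ennreal_plus)
    also have "\<dots> \<le> ennreal ((1/2) ^ n)"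
    proof (rule ennreal_leI)
      have "2 ^ n * (1/8) ^ n = (1/4 :: real) ^ n" by (simp flip: power_mult_distrib)
      also have "\<dots> \<le> (1/2) ^ n" by (intro power_mono) auto
      finally show "2 ^ n / 2 * (1/8) ^ n + (1/2) ^ n / 2 \<le> (1/2 :: real) ^ n" by simp
    qed
    finally show ?thesis .
  qed
  have "(\<integral>\<^sup>+\<xi>. (\<Sum>n. ennreal (norm (s (Suc n) \<xi> - s n \<xi>))) \<partial>torus d)
      = (\<Sum>n. \<integral>\<^sup>+\<xi>. ennreal (norm (s (Suc n) \<xi> - s n \<xi>)) \<partial>torus d)"
    by (rule nn_integral_suminf) simp
  also have "\<dots> \<le> (\<Sum>n. ennreal ((1/2) ^ n))"
    by (intro suminf_le L1) auto
  also have "\<dots> = ennreal 2"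
    by (subst suminf_ennreal2) (auto simp: suminf_geometric)
  finally have "AE \<xi> in torus d. (\<Sum>n. ennreal (norm (s (Suc n) \<xi> - s n \<xi>))) \<noteq> \<infinity>"
    by (intro nn_integral_PInf_AE) (auto simp: top_unique)
  then have lim: "AE \<xi> in torus d. (\<lambda>n. s n \<xi>) \<longlonglongrightarrow> lim (\<lambda>n. s n \<xi>)"
  proof eventually_elim
    case (elim \<xi>)
    then have "summable (\<lambda>n. norm (s (Suc n) \<xi> - s n \<xi>))"
      by (intro summable_suminf_not_top) auto
    then have "summable (\<lambda>n. s (Suc n) \<xi> - s n \<xi>)" by (rule summable_norm_cancel)
    then have "convergent (\<lambda>n. \<Sum>k<n. s (Suc k) \<xi> - s k \<xi>)" by (simp add: summable_iff_convergent)
    then have "convergent (\<lambda>n. s n \<xi> - s 0 \<xi>)" using sum_lessThan_telescope[of "\<lambda>k. s k \<xi>"] by simp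
    then have "convergent (\<lambda>n. s n \<xi> - s 0 \<xi> + s 0 \<xi>)" by (intro convergent_add convergent_const)
    then show ?case by (simp add: convergent_LIMSEQ_iff)
  qed
  \<comment> \<open>The partial sums diverge at most on a null set, so the value of
    \<open>lim\<close> there is irrelevant.\<close>
  define g where "g = (\<lambda>\<xi>. lim (\<lambda>n. s n \<xi>))"
  have [measurable]: "g \<in> borel_measurable (torus d)" unfolding g_def by measurable
  have close: "Lq_norm (torus d) 2 (\<lambda>\<xi>. g \<xi> - trig_poly d Y f \<xi>) \<le> ennreal ((1/2) ^ n)"
    if Y: "finite Y" "Y \<subseteq> int_lattice d" "H n \<subseteq> Y" for Y n
  proof -
    have "(\<integral>\<^sup>+\<xi>. ennreal ((norm (g \<xi> - trig_poly d Y f \<xi>))\<^sup>2) \<partial>torus d)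
        = (\<integral>\<^sup>+\<xi>. liminf (\<lambda>m. ennreal ((norm (s m \<xi> - trig_poly d Y f \<xi>))\<^sup>2)) \<partial>torus d)"
    proof (rule nn_integral_cong_AE)
      show "AE \<xi> in torus d. ennreal ((norm (g \<xi> - trig_poly d Y f \<xi>))\<^sup>2)
         = liminf (\<lambda>m. ennreal ((norm (s m \<xi> - trig_poly d Y f \<xi>))\<^sup>2))"
        using lim
      proof eventually_elim
        case (elim \<xi>)
        then have "(\<lambda>m. ennreal ((norm (s m \<xi> - trig_poly d Y f \<xi>))\<^sup>2)) \<longlonglongrightarrow> ennreal ((norm (g \<xi> - trig_poly d Y f \<xi>))\<^sup>2)"
          unfolding g_def by (intro tendsto_ennrealI tendsto_intros)
        then show ?case by (rule lim_imp_Liminf[OF trivial_limit_sequentially, symmetric])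
      qed
    qed
    also have "\<dots> \<le> liminf (\<lambda>m. \<integral>\<^sup>+\<xi>. ennreal ((norm (s m \<xi> - trig_poly d Y f \<xi>))\<^sup>2) \<partial>torus d)"
      by (rule nn_integral_liminf) simp
    also have "\<dots> \<le> limsup (\<lambda>m. \<integral>\<^sup>+\<xi>. ennreal ((norm (s m \<xi> - trig_poly d Y f \<xi>))\<^sup>2) \<partial>torus d)"
      by (rule Liminf_le_Limsup) simp
    \<comment> \<open>For m at least n both index sets contain \<open>H n\<close>, so
      \<open>L2\<close> applies eventually.\<close>
    also have "\<dots> \<le> ennreal ((1/8) ^ n)"
      unfolding s_def using H H_mono Y
      by (intro Limsup_bounded eventually_sequentiallyI[of n] L2) auto
    also have "\<dots> \<le> ennreal (((1/2) ^ n) powr 2)"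
    proof (rule ennreal_leI)
      have "(1/8 :: real) ^ n \<le> (1/4) ^ n" by (intro power_mono) auto
      also have "\<dots> = ((1/2) ^ n)\<^sup>2" by (simp add: power2_eq_square flip: power_mult_distrib)
      finally show "(1/8 :: real) ^ n \<le> ((1/2) ^ n) powr 2" by simp
    qed
    finally show ?thesis by (simp add: Lq_norm_le_iff)
  qed
  have "((\<lambda>Y. Lq_norm (torus d) 2 (\<lambda>\<xi>. g \<xi> - trig_poly d Y f \<xi>)) \<longlongrightarrow> 0)
      (finite_subsets_at_top (int_lattice d))"
  proof (rule order_tendstoI)
    fix e :: ennreal assume "0 < e"
    have "(\<lambda>n. ennreal ((1/2) ^ n)) \<longlonglongrightarrow> ennreal 0"
      by (intro tendsto_ennrealI LIMSEQ_power_zero) simp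
    then have "\<forall>\<^sub>F n in sequentially. ennreal ((1/2) ^ n) < e"
      using \<open>0 < e\<close> by (intro order_tendstoD(2)) auto
    then obtain n where "ennreal ((1/2) ^ n) < e" by (auto simp: eventually_sequentially)
    then show "\<forall>\<^sub>F Y in finite_subsets_at_top (int_lattice d).
        Lq_norm (torus d) 2 (\<lambda>\<xi>. g \<xi> - trig_poly d Y f \<xi>) < e"
      unfolding eventually_finite_subsets_at_top using H le_less_trans[OF close[of _ n]]
      by (intro exI[of _ "H n"]) auto
  qed simp
  then show ?thesis
    unfolding is_fourier_transform_def trig_poly_def[symmetric] by (intro exI[of _ g]) simp
qed

section \<open>Norms on the lattice and the sharpened inequality\<close>

lemma norm_le_lp_norm:
  assumes "in_lp E p f" "p > 0" "x \<in> E"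
  shows "norm (f x) \<le> lp_norm E p f"
proof -
  have "norm (f x) powr p \<le> (\<Sum>\<^sub>\<infinity>x\<in>E. norm (f x) powr p)"
    using finite_sum_le_infsum[of "\<lambda>x. norm (f x) powr p" E "{x}"] assms by (simp add: in_lp_def)
  then have "(norm (f x) powr p) powr (1 / p) \<le> lp_norm E p f"
    unfolding lp_norm_def using assms by (intro powr_mono2) auto
  then show ?thesis using assms by (simp add: powr_powr)
qed

lemma lp_norm_powr: "p > 0 \<Longrightarrow> lp_norm E p f powr p = (\<Sum>\<^sub>\<infinity>x\<in>E. norm (f x) powr p)"
  unfolding lp_norm_def by (simp add: powr_powr infsum_nonneg)

lemma norm_le_sup_norm:
  assumes "in_lp E p f" "p > 0" "x \<in> E"
  shows "norm (f x) \<le> sup_norm E f"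
  unfolding sup_norm_def using assms norm_le_lp_norm[OF assms(1,2)]
  by (intro cSUP_upper bdd_aboveI2[where M = "lp_norm E p f"]) auto

text \<open>Bounding the surplus power 2 - p by the norm puts l^p inside l^2, where
  \<open>exists_fourier_transform\<close> applies.\<close>

lemma in_lp_square_summable:
  assumes f: "in_lp E p f" and p: "0 < p" "p < 2"
  shows "(\<lambda>x. (norm (f x))\<^sup>2) summable_on E"
proof (rule summable_on_comparison_test)
  show "(\<lambda>x. norm (f x) powr p * lp_norm E p f powr (2 - p)) summable_on E"
    using f by (intro summable_on_cmult_left) (simp add: in_lp_def)
  fix x assume x: "x \<in> E"
  have "(norm (f x))\<^sup>2 = norm (f x) powr p * norm (f x) powr (2 - p)"
    by (cases "f x = 0") (simp_all flip: powr_add)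
  also have "\<dots> \<le> norm (f x) powr p * lp_norm E p f powr (2 - p)"
    using norm_le_lp_norm[OF f p(1) x] p by (intro mult_left_mono powr_mono2) auto
  finally show "(norm (f x))\<^sup>2 \<le> norm (f x) powr p * lp_norm E p f powr (2 - p)" .
qed simp

text \<open>On a finite set the bound holds with the norm of \<open>f\<close> on that set and the
  full supremum. Monotonicity replaces the former by the full norm, and
  \<open>is_fourier_transform_bound\<close> takes the limit.\<close>

theorem sharpened_Hausdorff_Young:
  assumes p: "1 < p" "p < 2" and f: "in_lp (int_lattice d) p f"
  shows "Lq_norm (torus d) (p / (p - 1)) (fourier_transform d f)
    \<le> ennreal ((1 - gain p) * lp_norm (int_lattice d) p f + gain p * sup_norm (int_lattice d) f)"
proof (rule is_fourier_transform_bound)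
  show "is_fourier_transform d f (fourier_transform d f)"
    unfolding fourier_transform_def
    by (rule someI_ex[where P = "is_fourier_transform d f"], rule exists_fourier_transform, rule in_lp_square_summable[OF f]) (use p in auto)
  have p0: "p > 0" using p by simp
  have "int_lattice d \<noteq> {}" by (simp add: int_lattice_def PiE_eq_empty_iff)
  then obtain x0 where "x0 \<in> int_lattice d" by blast
  then have S0: "0 \<le> sup_norm (int_lattice d) f"
    using order_trans[OF norm_ge_zero norm_le_sup_norm[OF f p0]] by simp
  have gain: "0 < gain p" "gain p < 1" using p by (auto intro: gain_pos gain_lt_1)
  have N0: "lp_norm E p f \<ge> 0" for E by (simp add: lp_norm_def)
  show "0 \<le> (1 - gain p) * lp_norm (int_lattice d) p f + gain p * sup_norm (int_lattice d) f"
    using S0 N0 gain by simp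
  fix F assume F: "finite F" "F \<subseteq> int_lattice d"
  define N where "N = (\<Sum>x\<in>F. norm (f x) powr p) powr (1 / p)"
  have "(\<integral>\<xi>. norm (trig_poly d F f \<xi>) powr (p / (p - 1)) \<partial>torus d)
      \<le> ((1 - gain p) * N + gain p * sup_norm (int_lattice d) f) powr (p / (p - 1))"
    using p F norm_le_sup_norm[OF f p0] S0
    by (intro Hausdorff_Young_trig_poly) (auto simp: N_def powr_powr sum_nonneg)
  also have "\<dots> \<le> ((1 - gain p) * lp_norm (int_lattice d) p f + gain p * sup_norm (int_lattice d) f) powr (p / (p - 1))"
  proof (intro powr_mono2 add_right_mono mult_left_mono)
    show "N \<le> lp_norm (int_lattice d) p f"
      unfolding N_def lp_norm_def using F f p0
      by (intro powr_mono2 finite_sum_le_infsum sum_nonneg) (auto simp: in_lp_def)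
    show "0 \<le> (1 - gain p) * N + gain p * sup_norm (int_lattice d) f"
      using S0 gain by (simp add: N_def)
  qed (use p gain in auto)
  finally show "(\<integral>\<xi>. norm (trig_poly d F f \<xi>) powr (p / (p - 1)) \<partial>torus d)
     \<le> ((1 - gain p) * lp_norm (int_lattice d) p f + gain p * sup_norm (int_lattice d) f) powr (p / (p - 1))" .
qed (use p in auto)

section \<open>From a large supremum to concentration at one point\<close>

lemma lp_norm_remove:
  assumes f: "in_lp E p f" and p: "p > 0" and z: "z \<in> E"
  shows "lp_norm (E - {z}) p f powr p = lp_norm E p f powr p - norm (f z) powr p"
proof -
  have "(\<Sum>\<^sub>\<infinity>x\<in>E. norm (f x) powr p) = (\<Sum>\<^sub>\<infinity>x\<in>{z} \<union> (E - {z}). norm (f x) powr p)"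
    using z by (simp add: insert_absorb)
  also have "\<dots> = norm (f z) powr p + (\<Sum>\<^sub>\<infinity>x\<in>E - {z}. norm (f x) powr p)"
    using f unfolding in_lp_def
    by (subst infsum_Un_disjoint) (auto intro: summable_on_subset_banach)
  finally show ?thesis using p by (simp add: lp_norm_powr)
qed

lemma lp_norm_pos:
  assumes "in_lp E p f" "p > 0" "x \<in> E" "f x \<noteq> 0"
  shows "lp_norm E p f > 0"
  using norm_le_lp_norm[OF assms(1-3)] assms(4) by (meson less_le_trans zero_less_norm_iff)

text \<open>Choose \<open>z\<close> nearly attaining the supremum; by \<open>lp_norm_remove\<close>
  the rest has p-th power at most (1 - (1 - \<eta>)^p) N^p.\<close>

lemma concentrated_if_sup_norm_large:
  assumes f: "in_lp E p f" and p: "1 < p" "p < 2" and N: "lp_norm E p f > 0" and E: "E \<noteq> {}"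
    and \<epsilon>: "\<epsilon> > 0" and \<eta>: "0 < \<eta>" "\<eta> \<le> 1 / 2" "\<eta> \<le> \<epsilon> powr p / 4"
    and S: "sup_norm E f > (1 - \<eta>) * lp_norm E p f"
  shows "\<exists>z\<in>E. lp_norm (E - {z}) p f < \<epsilon> * lp_norm E p f"
proof -
  define N where "N = lp_norm E p f"
  have p0: "p > 0" using p by simp
  have "bdd_above ((\<lambda>x. norm (f x)) ` E)"
    using norm_le_lp_norm[OF f p0] by (rule bdd_aboveI2)
  then obtain z where z: "z \<in> E" "(1 - \<eta>) * N < norm (f z)"
    using S less_cSUP_iff[OF E] unfolding sup_norm_def N_def by blast
  \<comment> \<open>As p < 2 and 1 - \<eta> lies in (0,1), the power p dominates the square. The
    rest is then at most 2\<eta> \<le> \<epsilon>^p / 2 relative to N^p, which leaves room for the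
    strict inequality.\<close>
  have "1 - 2 * \<eta> \<le> (1 - \<eta>) powr 2" using \<eta> by (simp add: power2_eq_square algebra_simps)
  also have "\<dots> \<le> (1 - \<eta>) powr p" using \<eta> p by (intro powr_mono') auto
  finally have \<eta>p: "1 - 2 * \<eta> \<le> (1 - \<eta>) powr p" .
  have Np: "N powr p > 0" using N by (simp add: N_def)
  have "lp_norm (E - {z}) p f powr p = N powr p - norm (f z) powr p"
    unfolding N_def by (rule lp_norm_remove[OF f p0 z(1)])
  also have "\<dots> \<le> N powr p - ((1 - \<eta>) * N) powr p"
    using z(2) \<eta> N p by (intro diff_left_mono powr_mono2) (auto simp: N_def)
  also have "\<dots> = N powr p * (1 - (1 - \<eta>) powr p)"
    by (subst powr_mult) (simp add: algebra_simps)
  also have "\<dots> < N powr p * \<epsilon> powr p"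
  proof (rule mult_strict_left_mono[OF _ Np])
    have "\<epsilon> powr p > 0" using \<epsilon> by simp
    then show "1 - (1 - \<eta>) powr p < \<epsilon> powr p" using \<eta>p \<eta>(3) by linarith
  qed
  also have "\<dots> = (\<epsilon> * N) powr p" using \<epsilon> N by (simp add: powr_mult N_def)
  finally have lt: "lp_norm (E - {z}) p f powr p < (\<epsilon> * N) powr p" .
  have "lp_norm (E - {z}) p f < \<epsilon> * N"
  proof (rule ccontr)
    assume "\<not> ?thesis"
    then have "(\<epsilon> * N) powr p \<le> lp_norm (E - {z}) p f powr p"
      using \<epsilon> N p by (intro powr_mono2) (auto simp: N_def)
    with lt show False by simp
  qed
  with z show ?thesis by (auto simp: N_def)
qed

theorem theorem1p3:
  fixes p p' :: real
  assumes "1 < p" and "p < 2" and "p' = p / (p - 1)"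
  shows
    "(\<forall>\<epsilon>::real. \<epsilon> > 0 \<longrightarrow> (\<exists>\<delta>::real. \<delta> > 0 \<and>
        (\<forall>d::nat. d \<ge> 1 \<longrightarrow> (\<forall>f. near_extremizer d p \<delta> f \<longrightarrow>
          (\<exists>z\<in>int_lattice d.
             lp_norm (int_lattice d - {z}) p f < \<epsilon> * lp_norm (int_lattice d) p f)))))
     \<and>
     (\<exists>(\<Lambda> :: real \<Rightarrow> real) (\<gamma>::real) (c::real).
        continuous_on {0<..1} \<Lambda> \<and> mono_on {0<..1} \<Lambda> \<and> \<Lambda> ` {0<..1} \<subseteq> {0<..1} \<and>
        \<gamma> > 0 \<and> c > 0 \<and>
        (\<forall>\<^sub>F t in at_left 1. \<Lambda> t \<le> 1 - c * (1 - t) powr \<gamma>) \<and>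
        (\<forall>d::nat. d \<ge> 1 \<longrightarrow> (\<forall>f :: (nat \<Rightarrow> int) \<Rightarrow> complex.
           in_lp (int_lattice d) p f \<longrightarrow> (\<exists>x\<in>int_lattice d. f x \<noteq> 0) \<longrightarrow>
           Lq_norm (torus d) p' (fourier_transform d f)
             \<le> ennreal (lp_norm (int_lattice d) p f
                  * \<Lambda> (sup_norm (int_lattice d) f / lp_norm (int_lattice d) p f)))))"
proof (rule conjI)
  define c where "c = gain p"
  have c: "0 < c" "c < 1" using assms by (auto simp: c_def intro: gain_pos gain_lt_1)
  note bound = sharpened_Hausdorff_Young[OF assms(1,2), folded c_def assms(3)]
  show "\<forall>\<epsilon>::real. \<epsilon> > 0 \<longrightarrow> (\<exists>\<delta>::real. \<delta> > 0 \<and>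
        (\<forall>d::nat. d \<ge> 1 \<longrightarrow> (\<forall>f. near_extremizer d p \<delta> f \<longrightarrow>
          (\<exists>z\<in>int_lattice d.
             lp_norm (int_lattice d - {z}) p f < \<epsilon> * lp_norm (int_lattice d) p f))))"
  proof (intro allI impI)
    fix \<epsilon> :: real assume \<epsilon>: "\<epsilon> > 0"
    define \<eta> where "\<eta> = min (1 / 2) (\<epsilon> powr p / 4)"
    have \<eta>: "0 < \<eta>" "\<eta> \<le> 1 / 2" "\<eta> \<le> \<epsilon> powr p / 4" using \<epsilon> by (auto simp: \<eta>_def)
    \<comment> \<open>With \<delta> = c \<eta> / 2 the sharpened inequality gives S \<ge> (1 -
      \<eta>/2) N; the halving makes S > (1 - \<eta>) N strict.\<close>
    show "\<exists>\<delta>::real. \<delta> > 0 \<and> (\<forall>d::nat. d \<ge> 1 \<longrightarrow> (\<forall>f. near_extremizer d p \<delta> f \<longrightarrow>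
          (\<exists>z\<in>int_lattice d. lp_norm (int_lattice d - {z}) p f < \<epsilon> * lp_norm (int_lattice d) p f)))"
    proof (intro exI[of _ "c * \<eta> / 2"] conjI allI impI)
      fix d f assume near: "near_extremizer d p (c * \<eta> / 2) f"
      define N S where "N = lp_norm (int_lattice d) p f" and "S = sup_norm (int_lattice d) f"
      obtain x where f: "in_lp (int_lattice d) p f" and x: "x \<in> int_lattice d" "f x \<noteq> 0"
        using near by (auto simp: near_extremizer_def)
      have N: "N > 0" unfolding N_def using f x assms by (intro lp_norm_pos) auto
      have "norm (f x) \<le> S" unfolding S_def using f x assms by (intro norm_le_sup_norm) auto
      then have S: "S \<ge> 0" using norm_ge_zero order_trans by blast
      have "ennreal ((1 - c * \<eta> / 2) * N) \<le> ennreal ((1 - c) * N + c * S)"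
        using near bound[OF f] unfolding near_extremizer_def assms(3)[symmetric] N_def S_def
        by (meson order_trans)
      then have "(1 - c * \<eta> / 2) * N \<le> (1 - c) * N + c * S"
        using N S c by (subst (asm) ennreal_le_iff) auto
      then have "c * ((1 - \<eta> / 2) * N) \<le> c * S" by (simp add: algebra_simps)
      then have "(1 - \<eta> / 2) * N \<le> S" using c by simp
      moreover have "(1 - \<eta>) * N < (1 - \<eta> / 2) * N" using N \<eta>(1) by (intro mult_strict_right_mono) auto
      ultimately have "(1 - \<eta>) * N < S" by linarith
      then show "\<exists>z\<in>int_lattice d. lp_norm (int_lattice d - {z}) p f < \<epsilon> * lp_norm (int_lattice d) p f"
        using f N x \<epsilon> \<eta> assms unfolding N_def S_def
        by (intro concentrated_if_sup_norm_large[where \<eta> = \<eta>]) auto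
    qed (use c \<eta> in auto)
  qed
  \<comment> \<open>Dividing the bound (1 - c) N + c S by N yields this function of t = S / N; on
    (0,1] its values exceed 1 - c > 0.\<close>
  define \<Lambda> where "\<Lambda> = (\<lambda>t::real. 1 - c * (1 - t))"
  show "\<exists>(\<Lambda> :: real \<Rightarrow> real) (\<gamma>::real) (c::real).
        continuous_on {0<..1} \<Lambda> \<and> mono_on {0<..1} \<Lambda> \<and> \<Lambda> ` {0<..1} \<subseteq> {0<..1} \<and>
        \<gamma> > 0 \<and> c > 0 \<and>
        (\<forall>\<^sub>F t in at_left 1. \<Lambda> t \<le> 1 - c * (1 - t) powr \<gamma>) \<and>
        (\<forall>d::nat. d \<ge> 1 \<longrightarrow> (\<forall>f :: (nat \<Rightarrow> int) \<Rightarrow> complex.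
           in_lp (int_lattice d) p f \<longrightarrow> (\<exists>x\<in>int_lattice d. f x \<noteq> 0) \<longrightarrow>
           Lq_norm (torus d) p' (fourier_transform d f)
             \<le> ennreal (lp_norm (int_lattice d) p f
                  * \<Lambda> (sup_norm (int_lattice d) f / lp_norm (int_lattice d) p f))))"
  proof (rule exI[of _ \<Lambda>], rule exI[of _ "1::real"], rule exI[of _ c], intro conjI allI impI)
    show "continuous_on {0<..1} \<Lambda>" unfolding \<Lambda>_def by (intro continuous_intros)
    show "mono_on {0<..1} \<Lambda>" using c by (auto simp: \<Lambda>_def intro!: mono_onI)
    show "\<Lambda> ` {0<..1} \<subseteq> {0<..1}"
    proof clarify
      fix t :: real assume t: "t \<in> {0<..1}"
      have "c * (1 - t) \<le> c * 1" using c t by (intro mult_left_mono) auto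
      moreover have "0 \<le> c * (1 - t)" using c t by simp
      ultimately show "\<Lambda> t \<in> {0<..1}" using c unfolding \<Lambda>_def greaterThanAtMost_iff by linarith
    qed
    \<comment> \<open>Left of 1 the base 1 - t is positive, so \<open>powr 1\<close> returns
      it.\<close>
    show "\<forall>\<^sub>F t in at_left 1. \<Lambda> t \<le> 1 - c * (1 - t) powr 1"
      unfolding eventually_at_filter by (simp add: \<Lambda>_def)
    fix d and f :: "(nat \<Rightarrow> int) \<Rightarrow> complex"
    assume f: "in_lp (int_lattice d) p f" and "\<exists>x\<in>int_lattice d. f x \<noteq> 0"
    then obtain x where x: "x \<in> int_lattice d" "f x \<noteq> 0" by blast
    have "lp_norm (int_lattice d) p f > 0"
      using assms(1) f x by (intro lp_norm_pos[where x = x]) auto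
    moreover have "N * \<Lambda> (S / N) = (1 - c) * N + c * S" if "N > 0" for N S
      using that by (simp add: \<Lambda>_def algebra_simps)
    ultimately show "Lq_norm (torus d) p' (fourier_transform d f)
       \<le> ennreal (lp_norm (int_lattice d) p f
             * \<Lambda> (sup_norm (int_lattice d) f / lp_norm (int_lattice d) p f))"
      using bound[OF f] by simp
  qed (use c in auto)
qed

end
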